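(* Let $d\in\mathbb{N}$, $\alpha\in(0,2)$, $m\ge 0$, let $\lambda,R>0$ and $R_2>R_1>R$. There exists a constant $C=C_{d,m,\alpha,R_1,R_2,R,\lambda}>0$ such that $$\mathbb{E}^x\big[e^{-\lambda T_R}\big]\ge C\, j_{m,\alpha}(|x|)\qquad\text{for all } x\in\mathbb{R}^d \text{ with } R_1\le|x|\le R_2.$$
   Context: For $z\ge 0$ let $\Phi_{m,\alpha}(z)=(z+m^{2/\alpha})^{\alpha/2}-m$, and let $L_{m,\alpha}=\Phi_{m,\alpha}(-\Delta)$ be the self-adjoint operator on $L^2(\mathbb{R}^d)$ given by the Fourier multiplier $\Phi_{m,\alpha}(|y|^2)$. $(X_t)_{t\ge 0}$ is the c\`adl\`ag L\'evy process in $\mathbb{R}^d$ with generator $-L_{m,\alpha}$, i.e. $\mathbb{E}^x[f(X_t)]=(e^{-tL_{m,\alpha}}f)(x)$, where $\mathbb{E}^x$ is expectation for the process started at $x$. Its L\'evy measure has density $j_{m,\alpha}(|x|)$, where for $r>0$ $$j_{m,\alpha}(r)=\frac{2^{\frac{\alpha-d}{2}}m^{\frac{d+\alpha}{2\alpha}}\alpha}{\pi^{d/2}\Gamma(1-\frac{\alpha}{2})}\,\frac{K_{(d+\alpha)/2}(m^{1/\alpha}r)}{r^{(d+\alpha)/2}}\ (m>0),\qquad j_{0,\alpha}(r)=\frac{2^\alpha\Gamma(\frac{d+\alpha}{2})}{\pi^{d/2}|\Gamma(-\frac{\alpha}{2})|}\,r^{-d-\alpha},$$ with $K_\rho$ the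 modified Bessel function of the third kind, $K_\rho(z)=\frac12(\frac z2)^\rho\int_0^\infty t^{-\rho-1}e^{-t-\frac{z^2}{4t}}dt$. $\mathcal{B}_R$ is the open ball of radius $R$ centred at $0$ and $T_R=\inf\{t>0:X_t\in\mathcal{B}_R\}$, with $e^{-\lambda T_R}=0$ on $\{T_R=\infty\}$. *)

theory Defs
  imports "HOL-Probability.Probability"
begin

definition square_integrable :: "('a::euclidean_space \<Rightarrow> complex) \<Rightarrow> bool" where
  "square_integrable f \<longleftrightarrow>
     f \<in> borel_measurable lborel \<and> integrable lborel (\<lambda>x. (norm (f x))\<^sup>2)"

definition L2_dist :: "('a::euclidean_space \<Rightarrow> complex) \<Rightarrow> ('a \<Rightarrow> complex) \<Rightarrow> real" where
  "L2_dist f g = sqrt (\<integral>x. (norm (f x - g x))\<^sup>2 \<partial>lborel)"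

definition fourier_integral :: "('a::euclidean_space \<Rightarrow> complex) \<Rightarrow> 'a \<Rightarrow> complex" where
  "fourier_integral f y =
     complex_of_real ((2 * pi) powr (- (real DIM('a) / 2))) *
     (\<integral>x. cis (- (x \<bullet> y)) * f x \<partial>lborel)"

text \<open>The unitary Fourier transform on \<open>L\<^sup>2\<close>, i.e. the \<open>L\<^sup>2\<close>-continuous extension of the
  Fourier integral from \<open>L\<^sup>1 \<inter> L\<^sup>2\<close>. It is a relation because elements of \<open>L\<^sup>2\<close> are
  represented by functions and the transform is determined only almost everywhere.\<close>

definition has_fourier_transform ::
    "('a::euclidean_space \<Rightarrow> complex) \<Rightarrow> ('a \<Rightarrow> complex) \<Rightarrow> bool" where
  "has_fourier_transform f F \<longleftrightarrow>
     square_integrable f \<and> square_integrable F \<and>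
     (\<exists>u :: nat \<Rightarrow> 'a \<Rightarrow> complex.
        (\<forall>n. integrable lborel (u n) \<and> square_integrable (u n) \<and>
             square_integrable (fourier_integral (u n))) \<and>
        (\<lambda>n. L2_dist (u n) f) \<longlonglongrightarrow> 0 \<and>
        (\<lambda>n. L2_dist (fourier_integral (u n)) F) \<longlonglongrightarrow> 0)"

text \<open>\<open>neg_laplacian_fun \<phi> f g\<close> says that \<open>f\<close> is in the domain of \<open>\<phi>(-\<Delta>)\<close> and
  \<open>g = \<phi>(-\<Delta>) f\<close>, where \<open>\<phi>(-\<Delta>)\<close> is the operator on \<open>L\<^sup>2\<close> given by
  the Fourier multiplier \<open>\<phi>(|y|\<^sup>2)\<close>.\<close>

definition neg_laplacian_fun ::
    "(real \<Rightarrow> real) \<Rightarrow> ('a::euclidean_space \<Rightarrow> complex) \<Rightarrow> ('a \<Rightarrow> complex) \<Rightarrow> bool" where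
  "neg_laplacian_fun \<phi> f g \<longleftrightarrow>
     (\<exists>F. has_fourier_transform f F \<and>
          has_fourier_transform g (\<lambda>y. complex_of_real (\<phi> ((norm y)\<^sup>2)) * F y))"

definition Phi :: "real \<Rightarrow> real \<Rightarrow> real \<Rightarrow> real" where
  "Phi m \<alpha> z = (z + m powr (2 / \<alpha>)) powr (\<alpha> / 2) - m"

text \<open>Since \<open>L = \<Phi>(-\<Delta>)\<close>, the functional calculus gives
  \<open>exp (-t L) = (exp \<circ> (-t \<Phi>))(-\<Delta>)\<close>; the relation reads \<open>g = exp (-t L) f\<close>.\<close>

definition semigroup_L ::
    "real \<Rightarrow> real \<Rightarrow> real \<Rightarrow> ('a::euclidean_space \<Rightarrow> complex) \<Rightarrow> ('a \<Rightarrow> complex) \<Rightarrow> bool" where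
  "semigroup_L m \<alpha> t = neg_laplacian_fun (\<lambda>z. exp (- t * Phi m \<alpha> z))"

definition cadlag :: "(real \<Rightarrow> 'a::euclidean_space) \<Rightarrow> bool" where
  "cadlag p \<longleftrightarrow>
     (\<forall>t\<ge>0. (p \<longlongrightarrow> p t) (at_right t)) \<and>
     (\<forall>t>0. \<exists>l. (p \<longlongrightarrow> l) (at_left t))"

text \<open>Only times \<open>t \<ge> 0\<close> matter. All paths are cadlag, not just almost all of them: the
  probability space need not be complete, and hitting times must be measurable. Stochastic
  continuity is a consequence of right-continuity and stationarity of the increments.\<close>

definition cadlag_levy_process ::
    "'w measure \<Rightarrow> (real \<Rightarrow> 'w \<Rightarrow> 'a::euclidean_space) \<Rightarrow> bool" where
  "cadlag_levy_process M X \<longleftrightarrow>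
     prob_space M \<and>
     (\<forall>t\<ge>0. X t \<in> borel_measurable M) \<and>
     (AE \<omega> in M. X 0 \<omega> = 0) \<and>
     (\<forall>(n::nat) (t::nat \<Rightarrow> real). 0 \<le> t 0 \<and> strict_mono t \<longrightarrow>
        prob_space.indep_vars M (\<lambda>_. borel) (\<lambda>i \<omega>. X (t (Suc i)) \<omega> - X (t i) \<omega>) {..<n}) \<and>
     (\<forall>s\<ge>0. \<forall>h\<ge>0.
        distr M borel (\<lambda>\<omega>. X (s + h) \<omega> - X s \<omega>) = distr M borel (\<lambda>\<omega>. X h \<omega> - X 0 \<omega>)) \<and>
     (\<forall>\<omega>\<in>space M. cadlag (\<lambda>t. X t \<omega>))"

text \<open>The expectation \<open>E\<^sup>x\<close> of a path functional \<open>\<Psi>\<close>: the Levy process started at \<open>x\<close>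
  is \<open>x + X\<close>, where \<open>X\<close> starts at \<open>0\<close>.\<close>

definition expectation_from ::
    "'w measure \<Rightarrow> (real \<Rightarrow> 'w \<Rightarrow> 'a::euclidean_space) \<Rightarrow> 'a \<Rightarrow>
     ((real \<Rightarrow> 'a) \<Rightarrow> 'b::{banach, second_countable_topology}) \<Rightarrow> 'b" where
  "expectation_from M X x \<Psi> = prob_space.expectation M (\<lambda>\<omega>. \<Psi> (\<lambda>t. x + X t \<omega>))"

text \<open>The generator of the process is \<open>-L\<close>: \<open>E\<^sup>x[f(X\<^sub>t)] = (exp (-t L) f)(x)\<close> as elements
  of \<open>L\<^sup>2\<close>, for all \<open>f\<close> in \<open>L\<^sup>2\<close>.\<close>

definition relativistic_stable_process ::
    "real \<Rightarrow> real \<Rightarrow> 'w measure \<Rightarrow> (real \<Rightarrow> 'w \<Rightarrow> 'a::euclidean_space) \<Rightarrow> bool" where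
  "relativistic_stable_process m \<alpha> M X \<longleftrightarrow>
     cadlag_levy_process M X \<and>
     (\<forall>t\<ge>0. \<forall>f. square_integrable f \<longrightarrow>
        semigroup_L m \<alpha> t f (\<lambda>x. expectation_from M X x (\<lambda>p. f (p t))))"

text \<open>The infimum of the empty set is \<open>\<infinity>\<close>.\<close>

definition hitting_time :: "real \<Rightarrow> (real \<Rightarrow> 'a::euclidean_space) \<Rightarrow> ereal" where
  "hitting_time R p = Inf {ereal t | t. 0 < t \<and> p t \<in> ball 0 R}"

definition exp_discount :: "real \<Rightarrow> ereal \<Rightarrow> real" where
  "exp_discount lam T = (if T = \<infinity> then 0 else exp (- lam * real_of_ereal T))"

definition bessel_K :: "real \<Rightarrow> real \<Rightarrow> real" where
  "bessel_K \<rho> z = 1 / 2 * (z / 2) powr \<rho> *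
     (LINT t:{0<..}|lborel. t powr (- \<rho> - 1) * exp (- t - z\<^sup>2 / (4 * t)))"

definition levy_density :: "nat \<Rightarrow> real \<Rightarrow> real \<Rightarrow> real \<Rightarrow> real" where
  "levy_density d m \<alpha> r =
     (if m = 0 then
        2 powr \<alpha> * Gamma ((real d + \<alpha>) / 2) / (pi powr (real d / 2) * \<bar>Gamma (- (\<alpha> / 2))\<bar>)
          * r powr (- real d - \<alpha>)
      else
        2 powr ((\<alpha> - real d) / 2) * m powr ((real d + \<alpha>) / (2 * \<alpha>)) * \<alpha>
          / (pi powr (real d / 2) * Gamma (1 - \<alpha> / 2))
          * (bessel_K ((real d + \<alpha>) / 2) (m powr (1 / \<alpha>) * r) / r powr ((real d + \<alpha>) / 2)))"

end

theory Submission
  imports Defs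
begin

text \<open>
  Put \<open>f x = max 0 (r - norm x)\<close> and let \<open>g\<^sub>n b\<close> be the expectation of \<open>f (b + X\<^sub>n)\<close>. Pairing the two
  Fourier transforms in the semigroup relation with modulated Gaussians and letting the Gaussians
  flatten out shows that, up to a constant, \<open>g\<^sub>n b\<close> is the inverse Fourier integral at \<open>b\<close> of
  \<open>exp (-n \<Phi>(|y|\<^sup>2))\<close> times the transform of \<open>f\<close>; in particular it does not depend on the choice of
  the process. If \<open>g\<^sub>n b\<close> vanished for all \<open>n \<ge> 1\<close>, polynomial approximation in the variable
  \<open>exp (-\<Phi>(|y|\<^sup>2))\<close> would give the same for the multiplier \<open>exp (-|y|\<^sup>2)\<close>, that is, for a strictly
  positive Gaussian average of \<open>f\<close>. Hence \<open>b + X\<^sub>n\<close> lies in the ball of radius \<open>r\<close> with positive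
  probability for some \<open>n\<close>. With \<open>r = R / 2\<close> and compactness the bound is uniform in the starting point;
  finally \<open>exp (-\<lambda> T\<^sub>R) \<ge> exp (-\<lambda> n)\<close> on the event that the process is in the open ball of radius \<open>R\<close>
  at time \<open>n\<close>, and the Levy density is bounded on \<open>[R\<^sub>1, R\<^sub>2]\<close>.
\<close>

section \<open>Gaussian Fourier integrals\<close>

lemma borel_measurable_cis [measurable (raw)]:
  "f \<in> borel_measurable M \<Longrightarrow> (\<lambda>x. cis (f x)) \<in> borel_measurable M"
  by (rule measurable_compose[OF _ borel_measurable_continuous_onI])
     (auto simp: cis_conv_exp intro!: continuous_intros)

text \<open>Lebesgue measure on a Euclidean space is the image of the product, over
  \<open>Basis\<close>, of one-dimensional Lebesgue measures. This lemma and the next reduce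
  integrals of coordinatewise products to dimension one.\<close>

lemma lborel_integrable_prod:
  fixes f :: "'a::euclidean_space \<Rightarrow> real \<Rightarrow> 'b::{real_normed_field,banach,second_countable_topology}"
  assumes "\<And>b. b \<in> Basis \<Longrightarrow> integrable lborel (f b)"
  shows "integrable lborel (\<lambda>x::'a. \<Prod>b\<in>Basis. f b (x \<bullet> b))"
proof -
  interpret product_sigma_finite "\<lambda>_::'a. lborel :: real measure" ..
  have [measurable]: "f b \<in> borel_measurable borel" if "b \<in> Basis" for b
    using assms[OF that] by auto
  have *: "integrable (\<Pi>\<^sub>M b\<in>Basis. lborel) (\<lambda>x. \<Prod>b\<in>Basis. f b (x b))"
    by (rule product_integrable_prod) (use assms in auto)
  show ?thesis
    by (subst lborel_eq, subst integrable_distr_eq)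
       (use * in \<open>auto simp: inner_sum_left inner_Basis if_distrib cong: if_cong prod.cong\<close>)
qed

lemma lborel_integral_prod:
  fixes f :: "'a::euclidean_space \<Rightarrow> real \<Rightarrow> 'b::{real_normed_field,banach,second_countable_topology}"
  assumes "\<And>b. b \<in> Basis \<Longrightarrow> integrable lborel (f b)"
  shows "(\<integral>x. (\<Prod>b\<in>(Basis::'a set). f b (x \<bullet> b)) \<partial>lborel) = (\<Prod>b\<in>Basis. \<integral>t. f b t \<partial>lborel)"
proof -
  interpret product_sigma_finite "\<lambda>_::'a. lborel :: real measure" ..
  have [measurable]: "f b \<in> borel_measurable borel" if "b \<in> Basis" for b
    using assms[OF that] by auto
  have *: "(\<integral>x. (\<Prod>b\<in>Basis. f b (x b)) \<partial>(\<Pi>\<^sub>M b\<in>(Basis::'a set). lborel)) = (\<Prod>b\<in>Basis. \<integral>t. f b t \<partial>lborel)"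
    by (rule product_integral_prod) (use assms in auto)
  show ?thesis
    by (subst lborel_eq, subst integral_distr)
       (use * in \<open>auto simp: inner_sum_left inner_Basis if_distrib cong: if_cong prod.cong\<close>)
qed

text \<open>The substitution \<open>u = c * t\<close> with \<open>c = sqrt (2 * s)\<close> turns the
  Gaussian into a multiple of the standard normal density, so the integral is a multiple of the
  known characteristic function at \<open>- x / c\<close>.\<close>

lemma gaussian_real:
  fixes x s :: real
  assumes "0 < s"
  shows "integrable lborel (\<lambda>t. exp (- s * t\<^sup>2))"
    and "(\<integral>t. cis (- (x * t)) * complex_of_real (exp (- s * t\<^sup>2)) \<partial>lborel)
           = complex_of_real (sqrt (pi / s) * exp (- x\<^sup>2 / (4 * s)))"
proof -
  define c where "c = sqrt (2 * s)"
  have c: "c > 0" "c\<^sup>2 = 2 * s" "c \<noteq> 0" using assms by (auto simp: c_def)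
  have d: "std_normal_density (c * t) = exp (- s * t\<^sup>2) / sqrt (2 * pi)" for t
    by (simp add: std_normal_density_def power_mult_distrib c)
  have "integrable lborel std_normal_density" by (rule integrable_normal_density) simp
  from lborel_integrable_real_affine[OF this c(3), of 0]
  have i: "integrable lborel (\<lambda>t. exp (- s * t\<^sup>2) / sqrt (2 * pi))"
    by (simp add: d)
  from integrable_mult_right[OF i, of "sqrt (2 * pi)"]
  show "integrable lborel (\<lambda>t. exp (- s * t\<^sup>2))" by simp
  have "complex_of_real (exp (- (- x / c)\<^sup>2 / 2)) = char std_normal_distribution (- x / c)"
    by (simp only: char_std_normal_distribution)
  also have "\<dots> = (\<integral>u. std_normal_density u *\<^sub>R cis ((- x / c) * u) \<partial>lborel)"
    unfolding char_def
    by (subst integral_density) (auto simp: cis_conv_exp)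
  also have "\<dots> = \<bar>c\<bar> *\<^sub>R (\<integral>t. std_normal_density (c * t) *\<^sub>R cis ((- x / c) * (c * t)) \<partial>lborel)"
    using lborel_integral_real_affine[OF c(3), of "\<lambda>u. std_normal_density u *\<^sub>R cis ((- x / c) * u)" 0]
    by simp
  also have "(\<lambda>t. std_normal_density (c * t) *\<^sub>R cis ((- x / c) * (c * t)))
     = (\<lambda>t. complex_of_real (1 / sqrt (2 * pi)) * (cis (- (x * t)) * complex_of_real (exp (- s * t\<^sup>2))))"
    unfolding d using c by (auto simp: scaleR_conv_of_real)
  finally have *: "complex_of_real (exp (- (- x / c)\<^sup>2 / 2)) = complex_of_real (c / sqrt (2 * pi)) *
     (\<integral>t. cis (- (x * t)) * complex_of_real (exp (- s * t\<^sup>2)) \<partial>lborel)"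
    using c by (simp add: scaleR_conv_of_real)
  have "sqrt (pi / s) = sqrt (2 * pi) / c" unfolding c_def using assms
    by (simp add: real_sqrt_divide real_sqrt_mult)
  moreover have "(- x / c)\<^sup>2 / 2 = x\<^sup>2 / (4 * s)" using c by (simp add: power_divide)
  moreover have "complex_of_real (sqrt (2 * pi) / c) * complex_of_real (c / sqrt (2 * pi)) = 1"
    unfolding of_real_mult[symmetric] using c by simp
  ultimately show "(\<integral>t. cis (- (x * t)) * complex_of_real (exp (- s * t\<^sup>2)) \<partial>lborel)
           = complex_of_real (sqrt (pi / s) * exp (- x\<^sup>2 / (4 * s)))"
    using * c(3) by (simp add: mult.assoc[symmetric])
qed

lemma exp_norm_power2_eq_prod:
  fixes y :: "'a::euclidean_space"
  shows "exp (- s * (norm y)\<^sup>2) = (\<Prod>b\<in>Basis. exp (- s * (y \<bullet> b)\<^sup>2))"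
proof -
  have "(norm y)\<^sup>2 = (\<Sum>b\<in>Basis. (y \<bullet> b)\<^sup>2)"
    by (subst power2_norm_eq_inner, subst euclidean_inner) (simp add: power2_eq_square)
  then show ?thesis by (simp add: exp_sum sum_distrib_left)
qed

lemma cis_sum: "finite A \<Longrightarrow> cis (sum f A) = (\<Prod>x\<in>A. cis (f x))"
  by (induction A rule: finite_induct) (auto simp flip: cis_mult)

lemma integrable_gaussian:
  assumes "0 < s"
  shows "integrable lborel (\<lambda>y::'a::euclidean_space. exp (- s * (norm y)\<^sup>2))"
  unfolding exp_norm_power2_eq_prod
  using lborel_integrable_prod[of "\<lambda>_ t. exp (- s * t\<^sup>2)"] gaussian_real(1)[OF assms] by simp

lemma integral_cis_gaussian:
  fixes x :: "'a::euclidean_space"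
  assumes "0 < s"
  shows "(\<integral>y. cis (- (x \<bullet> y)) * complex_of_real (exp (- s * (norm y)\<^sup>2)) \<partial>lborel)
     = complex_of_real ((pi / s) powr (DIM('a) / 2) * exp (- (norm x)\<^sup>2 / (4 * s)))"
proof -
  have "(\<integral>y. cis (- (x \<bullet> y)) * complex_of_real (exp (- s * (norm y)\<^sup>2)) \<partial>lborel)
    = (\<integral>y. (\<Prod>b\<in>Basis. cis (- ((x \<bullet> b) * (y \<bullet> b))) * complex_of_real (exp (- s * (y \<bullet> b)\<^sup>2))) \<partial>lborel)"
    unfolding exp_norm_power2_eq_prod
    by (subst euclidean_inner) (simp add: cis_sum prod.distrib flip: sum_negf)
  also have "\<dots> = (\<Prod>b\<in>Basis. \<integral>t. cis (- ((x \<bullet> b) * t)) * complex_of_real (exp (- s * t\<^sup>2)) \<partial>lborel)"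
  proof (rule lborel_integral_prod)
    fix b :: 'a
    have "integrable lborel (\<lambda>t. complex_of_real (exp (- s * t\<^sup>2)))"
      using gaussian_real(1)[OF assms] by (rule integrable_of_real)
    then show "integrable lborel (\<lambda>t. cis (- ((x \<bullet> b) * t)) * complex_of_real (exp (- s * t\<^sup>2)))"
      by (rule Bochner_Integration.integrable_bound) (auto simp: norm_mult)
  qed
  also have "\<dots> = complex_of_real (\<Prod>b\<in>(Basis::'a set). sqrt (pi / s) * exp (- (1 / (4 * s)) * (x \<bullet> b)\<^sup>2))"
    unfolding gaussian_real(2)[OF assms] by (simp add: of_real_prod)
  also have "(\<Prod>b\<in>(Basis::'a set). sqrt (pi / s) * exp (- (1 / (4 * s)) * (x \<bullet> b)\<^sup>2))
     = sqrt (pi / s) ^ DIM('a) * exp (- (1 / (4 * s)) * (norm x)\<^sup>2)"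
    unfolding exp_norm_power2_eq_prod by (simp add: prod.distrib)
  also have "sqrt (pi / s) ^ DIM('a) = (pi / s) powr (DIM('a) / 2)"
    using assms by (simp add: powr_half_sqrt[symmetric] powr_powr flip: powr_realpow)
  finally show ?thesis by simp
qed

text \<open>Modulating by \<open>b\<close> translates the transform of the centred Gaussian to
  \<open>b\<close>. For small \<open>s\<close> the result concentrates near \<open>b\<close>, which
  later recovers point values.\<close>

lemma fourier_integral_cis_gaussian:
  fixes x b :: "'a::euclidean_space"
  assumes "0 < s"
  shows "fourier_integral (\<lambda>y. cis (y \<bullet> b) * complex_of_real (exp (- s * (norm y)\<^sup>2))) x
     = complex_of_real ((2 * s) powr - (DIM('a) / 2) * exp (- (norm (x - b))\<^sup>2 / (4 * s)))"
proof -
  have "(\<integral>y. cis (- (y \<bullet> x)) * (cis (y \<bullet> b) * complex_of_real (exp (- s * (norm y)\<^sup>2))) \<partial>lborel)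
    = (\<integral>y. cis (- ((x - b) \<bullet> y)) * complex_of_real (exp (- s * (norm y)\<^sup>2)) \<partial>lborel)"
    unfolding mult.assoc[symmetric] cis_mult
    by (simp add: inner_diff_right inner_commute)
  moreover have "(2 * pi) powr - (DIM('a) / 2) * (pi / s) powr (DIM('a) / 2) = (2 * s) powr - (DIM('a) / 2)"
    using assms by (simp add: powr_minus_divide powr_divide powr_mult)
  ultimately show ?thesis
    unfolding fourier_integral_def integral_cis_gaussian[OF assms]
    by (metis (no_types, lifting) mult.assoc of_real_mult)
qed

section \<open>Pairings with Fourier transforms\<close>

lemma norm_fourier_integral_le:
  fixes u :: "'a::euclidean_space \<Rightarrow> complex"
  shows "norm (fourier_integral u y) \<le> (2 * pi) powr (- (DIM('a) / 2)) * (\<integral>x. norm (u x) \<partial>lborel)"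
proof -
  have "norm (\<integral>x. cis (- (x \<bullet> y)) * u x \<partial>lborel) \<le> (\<integral>x. norm (cis (- (x \<bullet> y)) * u x) \<partial>lborel)"
    by (rule integral_norm_bound)
  then show ?thesis unfolding fourier_integral_def
    by (simp add: norm_mult mult_left_mono)
qed

lemma borel_measurable_fourier_integral:
  fixes u :: "'a::euclidean_space \<Rightarrow> complex"
  assumes [measurable]: "u \<in> borel_measurable borel"
  shows "fourier_integral u \<in> borel_measurable borel"
  unfolding fourier_integral_def by measurable

text \<open>Fubini for a kernel that is absolutely integrable because \<open>cis\<close> has modulus
  one; the exponent is symmetric in \<open>x\<close> and \<open>y\<close>.\<close>

lemma fourier_multiplication_formula:
  fixes u h :: "'a::euclidean_space \<Rightarrow> complex"
  assumes u: "integrable lborel u" and h: "integrable lborel h"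
  shows "(\<integral>y. fourier_integral u y * h y \<partial>lborel) = (\<integral>x. u x * fourier_integral h x \<partial>lborel)"
proof -
  have [measurable]: "u \<in> borel_measurable borel" "h \<in> borel_measurable borel"
    using u h by auto
  let ?k = "\<lambda>x y. cis (- (x \<bullet> y)) * u x * h y"
  have "integrable (lborel \<Otimes>\<^sub>M lborel) (\<lambda>(x, y). ?k x y)"
  proof (rule lborel_pair.Fubini_integrable)
    show "integrable lborel (\<lambda>x. \<integral>y. norm (case (x, y) of (x, y) \<Rightarrow> ?k x y) \<partial>lborel)"
      using u by (auto simp: norm_mult)
    show "AE x in lborel. integrable lborel (\<lambda>y. case (x, y) of (x, y) \<Rightarrow> ?k x y)"
    proof (rule AE_I2)
      fix x
      show "integrable lborel (\<lambda>y. case (x, y) of (x, y) \<Rightarrow> ?k x y)"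
        by (rule Bochner_Integration.integrable_bound[where f="\<lambda>y. u x * h y"])
           (use h in \<open>auto simp: norm_mult\<close>)
    qed
  qed measurable
  then have "(\<integral>y. \<integral>x. ?k x y \<partial>lborel \<partial>lborel) = (\<integral>x. \<integral>y. ?k x y \<partial>lborel \<partial>lborel)"
    by (rule lborel_pair.Fubini_integral)
  moreover have "(\<integral>x. ?k x y \<partial>lborel) = (\<integral>x. cis (- (x \<bullet> y)) * u x \<partial>lborel) * h y" for y
    by simp
  moreover have "(\<integral>y. ?k x y \<partial>lborel) = u x * (\<integral>y. cis (- (y \<bullet> x)) * h y \<partial>lborel)" for x
  proof -
    have "(\<lambda>y. ?k x y) = (\<lambda>y. u x * (cis (- (y \<bullet> x)) * h y))"
      by (auto simp: inner_commute)
    then show ?thesis by simp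
  qed
  ultimately show ?thesis
    unfolding fourier_integral_def by (simp add: mult.assoc mult.left_commute[of "u _"])
qed

section \<open>Bilinear pairings of square integrable functions and their continuity\<close>

lemma square_integrable_mult_integrable:
  fixes f g :: "'a::euclidean_space \<Rightarrow> complex"
  assumes "square_integrable f" "square_integrable g"
  shows "integrable lborel (\<lambda>x. f x * g x)"
proof -
  have "integrable lborel (\<lambda>x. (norm (f x))\<^sup>2 + (norm (g x))\<^sup>2)"
    using assms by (auto simp: square_integrable_def)
  then show ?thesis
  proof (rule Bochner_Integration.integrable_bound)
    show "AE x in lborel. norm (f x * g x) \<le> norm ((norm (f x))\<^sup>2 + (norm (g x))\<^sup>2)"
    proof (rule AE_I2)
      fix x
      have "2 * (norm (f x) * norm (g x)) \<le> (norm (f x))\<^sup>2 + (norm (g x))\<^sup>2"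
        using sum_squares_bound[of "norm (f x)" "norm (g x)"] by simp
      moreover have "0 \<le> norm (f x) * norm (g x)" by simp
      ultimately show "norm (f x * g x) \<le> norm ((norm (f x))\<^sup>2 + (norm (g x))\<^sup>2)"
        unfolding norm_mult real_norm_def by linarith
    qed
  qed (use assms in \<open>auto simp: square_integrable_def\<close>)
qed

lemma square_integrable_diff:
  fixes f g :: "'a::euclidean_space \<Rightarrow> complex"
  assumes "square_integrable f" "square_integrable g"
  shows "square_integrable (\<lambda>x. f x - g x)"
proof -
  have "integrable lborel (\<lambda>x. 2 * ((norm (f x))\<^sup>2 + (norm (g x))\<^sup>2))"
    using assms by (auto simp: square_integrable_def)
  then have "integrable lborel (\<lambda>x. (norm (f x - g x))\<^sup>2)"
  proof (rule Bochner_Integration.integrable_bound)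
    show "AE x in lborel. norm ((norm (f x - g x))\<^sup>2) \<le> norm (2 * ((norm (f x))\<^sup>2 + (norm (g x))\<^sup>2))"
    proof (rule AE_I2)
      fix x
      have "(norm (f x - g x))\<^sup>2 \<le> (norm (f x) + norm (g x))\<^sup>2"
        by (intro power_mono norm_triangle_ineq4) auto
      also have "\<dots> \<le> 2 * ((norm (f x))\<^sup>2 + (norm (g x))\<^sup>2)"
        using sum_squares_bound[of "norm (f x)" "norm (g x)"] by (simp add: power2_sum)
      finally show "norm ((norm (f x - g x))\<^sup>2) \<le> norm (2 * ((norm (f x))\<^sup>2 + (norm (g x))\<^sup>2))"
        by simp
    qed
  qed (use assms in \<open>auto simp: square_integrable_def\<close>)
  then show ?thesis using assms by (auto simp: square_integrable_def)
qed

lemma L2_Cauchy_Schwarz: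
  fixes f g :: "'a::euclidean_space \<Rightarrow> complex"
  assumes f: "square_integrable f" and g: "square_integrable g"
  shows "norm (\<integral>x. f x * g x \<partial>lborel)
    \<le> sqrt (\<integral>x. (norm (f x))\<^sup>2 \<partial>lborel) * sqrt (\<integral>x. (norm (g x))\<^sup>2 \<partial>lborel)"
proof -
  have [measurable]: "f \<in> borel_measurable borel" "g \<in> borel_measurable borel"
    using f g by (auto simp: square_integrable_def)
  let ?I = "\<integral>x. norm (f x * g x) \<partial>lborel"
  have fg: "integrable lborel (\<lambda>x. norm (f x * g x))"
    using square_integrable_mult_integrable[OF f g] by (rule integrable_norm)
  have "(\<integral>\<^sup>+x. ennreal (norm (f x)) * ennreal (norm (g x)) \<partial>lborel)\<^sup>2
      \<le> (\<integral>\<^sup>+x. (ennreal (norm (f x)))\<^sup>2 \<partial>lborel) * (\<integral>\<^sup>+x. (ennreal (norm (g x)))\<^sup>2 \<partial>lborel)"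
    by (rule Cauchy_Schwarz_nn_integral) auto
  moreover have "(\<integral>\<^sup>+x. ennreal (norm (f x)) * ennreal (norm (g x)) \<partial>lborel) = ennreal ?I"
    using nn_integral_eq_integral[OF fg] by (simp add: norm_mult ennreal_mult)
  moreover have "(\<integral>\<^sup>+x. (ennreal (norm (f x)))\<^sup>2 \<partial>lborel) = ennreal (\<integral>x. (norm (f x))\<^sup>2 \<partial>lborel)"
    using f by (subst nn_integral_eq_integral[symmetric]) (auto simp: square_integrable_def ennreal_power)
  moreover have "(\<integral>\<^sup>+x. (ennreal (norm (g x)))\<^sup>2 \<partial>lborel) = ennreal (\<integral>x. (norm (g x))\<^sup>2 \<partial>lborel)"
    using g by (subst nn_integral_eq_integral[symmetric]) (auto simp: square_integrable_def ennreal_power)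
  ultimately have "ennreal (?I\<^sup>2) \<le> ennreal ((\<integral>x. (norm (f x))\<^sup>2 \<partial>lborel) * (\<integral>x. (norm (g x))\<^sup>2 \<partial>lborel))"
    by (simp add: ennreal_mult ennreal_power)
  then have "?I\<^sup>2 \<le> (\<integral>x. (norm (f x))\<^sup>2 \<partial>lborel) * (\<integral>x. (norm (g x))\<^sup>2 \<partial>lborel)"
    by (subst (asm) ennreal_le_iff) auto
  then have "sqrt (?I\<^sup>2) \<le> sqrt ((\<integral>x. (norm (f x))\<^sup>2 \<partial>lborel) * (\<integral>x. (norm (g x))\<^sup>2 \<partial>lborel))"
    by (rule real_sqrt_le_mono)
  then have "?I \<le> sqrt (\<integral>x. (norm (f x))\<^sup>2 \<partial>lborel) * sqrt (\<integral>x. (norm (g x))\<^sup>2 \<partial>lborel)"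
    by (simp add: real_sqrt_mult)
  then show ?thesis by (rule order_trans[OF integral_norm_bound])
qed

text \<open>By Cauchy-Schwarz, pairing with a fixed square integrable function is continuous for the
  L2 distance.\<close>

lemma L2_dist_tendsto_integral:
  fixes f h :: "'a::euclidean_space \<Rightarrow> complex"
  assumes "\<And>n. square_integrable (u n)" "square_integrable f" "square_integrable h"
    and lim: "(\<lambda>n. L2_dist (u n) f) \<longlonglongrightarrow> 0"
  shows "(\<lambda>n. \<integral>x. u n x * h x \<partial>lborel) \<longlonglongrightarrow> (\<integral>x. f x * h x \<partial>lborel)"
proof -
  let ?K = "sqrt (\<integral>x. (norm (h x))\<^sup>2 \<partial>lborel)"
  have le: "norm ((\<integral>x. u n x * h x \<partial>lborel) - (\<integral>x. f x * h x \<partial>lborel)) \<le> L2_dist (u n) f * ?K" for n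
  proof -
    have "(\<integral>x. u n x * h x \<partial>lborel) - (\<integral>x. f x * h x \<partial>lborel) = (\<integral>x. (u n x - f x) * h x \<partial>lborel)"
      unfolding left_diff_distrib
      by (rule Bochner_Integration.integral_diff[symmetric]; rule square_integrable_mult_integrable; rule assms)
    then show ?thesis unfolding L2_dist_def
      using L2_Cauchy_Schwarz[OF square_integrable_diff[OF assms(1)[of n] assms(2)] assms(3)] by simp
  qed
  have "(\<lambda>n. (\<integral>x. u n x * h x \<partial>lborel) - (\<integral>x. f x * h x \<partial>lborel)) \<longlonglongrightarrow> 0"
    by (rule Lim_null_comparison[OF always_eventually[rule_format, OF le]])
       (rule tendsto_mult_left_zero[OF lim])
  then show ?thesis by (rule LIM_zero_cancel)
qed

text \<open>The multiplication formula holds for each approximant \<open>u n\<close>, and both of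
  its sides pass to the L2 limit. This turns the relational transform into usable equations between
  integrals.\<close>

lemma has_fourier_transform_pairing:
  fixes f F h :: "'a::euclidean_space \<Rightarrow> complex"
  assumes fF: "has_fourier_transform f F"
    and h: "integrable lborel h" "square_integrable h" "square_integrable (fourier_integral h)"
  shows "(\<integral>y. F y * h y \<partial>lborel) = (\<integral>x. f x * fourier_integral h x \<partial>lborel)"
proof -
  from fF obtain u where u: "\<And>n. integrable lborel (u n)" "\<And>n. square_integrable (u n)"
      "\<And>n. square_integrable (fourier_integral (u n))"
    and lim: "(\<lambda>n. L2_dist (u n) f) \<longlonglongrightarrow> 0" "(\<lambda>n. L2_dist (fourier_integral (u n)) F) \<longlonglongrightarrow> 0"
    and sq: "square_integrable f" "square_integrable F"
    unfolding has_fourier_transform_def by blast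
  have "(\<lambda>n. \<integral>y. fourier_integral (u n) y * h y \<partial>lborel) \<longlonglongrightarrow> (\<integral>y. F y * h y \<partial>lborel)"
    by (rule L2_dist_tendsto_integral) (use u sq h lim in auto)
  moreover have "(\<lambda>n. \<integral>x. u n x * fourier_integral h x \<partial>lborel) \<longlonglongrightarrow> (\<integral>x. f x * fourier_integral h x \<partial>lborel)"
    by (rule L2_dist_tendsto_integral) (use u sq h lim in auto)
  ultimately show ?thesis
    unfolding fourier_multiplication_formula[OF u(1) h(1)] by (rule LIMSEQ_unique)
qed

section \<open>Polynomial approximation\<close>

text \<open>By Stone-Weierstrass some polynomial \<open>q\<close> is within \<open>e\<close> of
  \<open>\<theta>\<close> on the unit interval. The integral against \<open>q\<close> is a
  combination of moments, hence zero, so the integral against \<open>\<theta>\<close> is at most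
  \<open>e\<close> times the L1 norm of \<open>D\<close>.\<close>

lemma moments_zero_imp_integral_zero:
  fixes D :: "'a \<Rightarrow> complex" and \<psi> :: "'a \<Rightarrow> real" and \<theta> :: "real \<Rightarrow> real"
  assumes D: "integrable M D" and [measurable]: "\<psi> \<in> borel_measurable M"
    and \<psi>: "\<And>x. \<psi> x \<in> {0..1}"
    and zero: "\<And>j::nat. (\<integral>x. D x * of_real (\<psi> x ^ j) \<partial>M) = 0"
    and \<theta>: "continuous_on {0..1} \<theta>" and [measurable]: "(\<lambda>x. \<theta> (\<psi> x)) \<in> borel_measurable M"
  shows "(\<integral>x. D x * of_real (\<theta> (\<psi> x)) \<partial>M) = 0"
proof -
  have [measurable]: "D \<in> borel_measurable M" using D by auto
  let ?L = "\<integral>x. norm (D x) \<partial>M"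
  have bdd: "integrable M (\<lambda>x. D x * of_real (k x))" if "k \<in> borel_measurable M" "\<And>x. \<bar>k x\<bar> \<le> B" for k B
  proof (rule Bochner_Integration.integrable_bound[where f="\<lambda>x. of_real B * D x"])
    show "AE x in M. norm (D x * of_real (k x)) \<le> norm (of_real B * D x)"
    proof (rule AE_I2)
      fix x
      have "norm (D x * of_real (k x)) = \<bar>k x\<bar> * norm (D x)" by (simp add: norm_mult)
      also have "\<dots> \<le> \<bar>B\<bar> * norm (D x)"
        using that(2)[of x] by (intro mult_right_mono) auto
      finally show "norm (D x * of_real (k x)) \<le> norm (of_real B * D x)" by (simp add: norm_mult)
    qed
  qed (use D that in auto)
  obtain B where B: "\<And>t. t \<in> {0..1} \<Longrightarrow> \<bar>\<theta> t\<bar> \<le> B"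
    using compact_imp_bounded[OF compact_continuous_image[OF \<theta> compact_Icc]]
    by (force simp: bounded_iff)
  have le: "norm (\<integral>x. D x * of_real (\<theta> (\<psi> x)) \<partial>M) \<le> e * ?L" if "e > 0" for e
  proof -
    obtain q where q: "real_polynomial_function q" "\<And>t. t \<in> {0..1} \<Longrightarrow> \<bar>\<theta> t - q t\<bar> < e"
      using Stone_Weierstrass_real_polynomial_function[OF compact_Icc \<theta> \<open>e > 0\<close>] by auto
    then obtain a n where qa: "q = (\<lambda>t. \<Sum>i\<le>n. a i * t ^ i)"
      unfolding real_polynomial_function_iff_sum by blast
    have pw: "integrable M (\<lambda>x. D x * of_real (\<psi> x ^ j))" for j
      by (rule bdd[where B=1]) (use \<psi> in \<open>auto simp: power_abs intro!: power_le_one\<close>)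
    have q0: "(\<integral>x. D x * of_real (q (\<psi> x)) \<partial>M) = 0"
    proof -
      have "(\<lambda>x. D x * of_real (q (\<psi> x))) = (\<lambda>x. \<Sum>i\<le>n. of_real (a i) * (D x * of_real (\<psi> x ^ i)))"
        by (simp add: qa sum_distrib_left mult.left_commute)
      then have "(\<integral>x. D x * of_real (q (\<psi> x)) \<partial>M) = (\<Sum>i\<le>n. of_real (a i) * (\<integral>x. D x * of_real (\<psi> x ^ i) \<partial>M))"
        using pw by simp
      then show ?thesis by (simp only: zero mult_zero_right sum.neutral_const)
    qed
    have qi: "integrable M (\<lambda>x. D x * of_real (q (\<psi> x)))"
    proof (rule bdd[where B="B + e"])
      fix x show "\<bar>q (\<psi> x)\<bar> \<le> B + e" using q(2)[OF \<psi>[of x]] B[OF \<psi>[of x]] by linarith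
    qed (simp add: qa)
    have ti: "integrable M (\<lambda>x. D x * of_real (\<theta> (\<psi> x)))"
      by (rule bdd[where B=B]) (use B \<psi> in auto)
    have "(\<integral>x. D x * of_real (\<theta> (\<psi> x)) \<partial>M) = (\<integral>x. D x * of_real (\<theta> (\<psi> x)) - D x * of_real (q (\<psi> x)) \<partial>M)"
      using qi ti q0 by simp
    also have "norm \<dots> \<le> (\<integral>x. norm (D x * of_real (\<theta> (\<psi> x)) - D x * of_real (q (\<psi> x))) \<partial>M)"
      by (rule integral_norm_bound)
    also have "\<dots> \<le> (\<integral>x. e * norm (D x) \<partial>M)"
    proof (rule integral_mono)
      fix x
      have "norm (D x * of_real (\<theta> (\<psi> x)) - D x * of_real (q (\<psi> x))) = norm (D x) * \<bar>\<theta> (\<psi> x) - q (\<psi> x)\<bar>"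
        by (simp add: norm_mult flip: right_diff_distrib of_real_diff)
      also have "\<dots> \<le> e * norm (D x)"
        using q(2)[OF \<psi>[of x]] by (subst mult.commute) (auto intro!: mult_right_mono)
      finally show "norm (D x * of_real (\<theta> (\<psi> x)) - D x * of_real (q (\<psi> x))) \<le> e * norm (D x)" .
    qed (use D qi ti in auto)
    finally show ?thesis by simp
  qed
  have "norm (\<integral>x. D x * of_real (\<theta> (\<psi> x)) \<partial>M) \<le> 0"
  proof (rule field_le_epsilon)
    fix e :: real assume "0 < e"
    have L: "0 \<le> ?L" by simp
    \<comment> \<open>The summand 1 in the denominator covers the case
      \<open>?L = 0\<close>.\<close>
    have "norm (\<integral>x. D x * of_real (\<theta> (\<psi> x)) \<partial>M) \<le> e / (?L + 1) * ?L"
      by (rule le) (use \<open>0 < e\<close> L in \<open>intro divide_pos_pos add_nonneg_pos zero_less_one\<close>)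
    also have "\<dots> = e * (?L / (?L + 1))" by simp
    also have "\<dots> \<le> e * 1"
      using \<open>0 < e\<close> L by (intro mult_left_mono) (simp_all only: divide_le_eq_1, linarith+)
    finally show "norm (\<integral>x. D x * of_real (\<theta> (\<psi> x)) \<partial>M) \<le> 0 + e" by simp
  qed
  then show ?thesis by simp
qed

text \<open>The substitution \<open>v = exp (- \<psi> x)\<close> turns Laplace data at the naturals
  into moments. The function \<open>g (- ln v)\<close> extends continuously to \<open>v = 0\<close>
  with value 0 precisely because \<open>g\<close> vanishes at infinity.\<close>

lemma laplace_zero_imp_integral_zero:
  fixes D :: "'a \<Rightarrow> complex" and \<psi> :: "'a \<Rightarrow> real" and g :: "real \<Rightarrow> real"
  assumes D: "integrable M D" and \<psi>[measurable]: "\<psi> \<in> borel_measurable M"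
    and nonneg: "\<And>x. 0 \<le> \<psi> x"
    and zero: "\<And>j::nat. (\<integral>x. D x * of_real (exp (- real j * \<psi> x)) \<partial>M) = 0"
    and g: "continuous_on {0..} g" and lim: "(g \<longlongrightarrow> 0) at_top"
  shows "(\<integral>x. D x * of_real (g (\<psi> x)) \<partial>M) = 0"
proof -
  define \<theta> where "\<theta> v = (if v = 0 then 0 else g (- ln v))" for v
  have eq: "g (\<psi> x) = \<theta> (exp (- \<psi> x))" for x by (simp add: \<theta>_def)
  \<comment> \<open>Measurability of the composition needs a continuous function on the whole line;
    clipping at 0 extends \<open>g\<close> without changing it at the nonnegative values of
    \<open>\<psi>\<close>.\<close>
  have g': "continuous_on UNIV (\<lambda>t. g (max 0 t))"
    by (rule continuous_on_compose2[OF g]) (auto intro!: continuous_intros)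
  have "(\<lambda>x. g (max 0 (\<psi> x))) \<in> borel_measurable M"
    by (rule measurable_compose[OF \<psi> borel_measurable_continuous_onI[OF g']])
  then have meas: "(\<lambda>x. g (\<psi> x)) \<in> borel_measurable M" by (simp add: nonneg max_def)
  have cont: "continuous_on {0..1} \<theta>"
    unfolding continuous_on_def
  proof
    fix v :: real assume v: "v \<in> {0..1}"
    show "(\<theta> \<longlongrightarrow> \<theta> v) (at v within {0..1})"
    proof (cases "v = 0")
      case True
      have "((\<lambda>v. g (- ln v)) \<longlongrightarrow> 0) (at_right 0)"
        by (rule filterlim_compose[OF lim])
           (simp add: filterlim_uminus_at_top ln_at_0)
      moreover have "eventually (\<lambda>v. g (- ln v) = \<theta> v) (at_right 0)"
        by (auto simp: \<theta>_def eventually_at_filter)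
      ultimately have "(\<theta> \<longlongrightarrow> 0) (at_right 0)" by (rule Lim_transform_eventually)
      then have "(\<theta> \<longlongrightarrow> 0) (at 0 within {0..1})"
        by (subst at_within_Icc_at_right) auto
      then show ?thesis using True by (simp add: \<theta>_def)
    next
      case False
      have "continuous_on {0<..1} (\<lambda>v. g (- ln v))"
        by (rule continuous_on_compose2[OF g]) (auto intro!: continuous_intros)
      then have "continuous_on {0<..1} \<theta>"
        by (rule continuous_on_eq) (auto simp: \<theta>_def)
      then have "(\<theta> \<longlongrightarrow> \<theta> v) (at v within {0<..1})"
        using v False by (auto simp: continuous_on_def)
      moreover have "at v within {0<..1} = at v within {0..1}"
        by (rule at_within_nhd[of _ "{0<..}"]) (use v False in auto)
      ultimately show ?thesis by simp
    qed
  qed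
  show ?thesis
    unfolding eq
  proof (rule moments_zero_imp_integral_zero[OF D _ _ _ cont])
    show "exp (- \<psi> x) \<in> {0..1}" for x using nonneg[of x] by simp
    show "(\<integral>x. D x * of_real (exp (- \<psi> x) ^ j) \<partial>M) = 0" for j :: nat
      using zero[of j] by (simp add: exp_of_nat_mult[symmetric])
    show "(\<lambda>x. \<theta> (exp (- \<psi> x))) \<in> borel_measurable M"
      using meas by (simp only: eq)
  qed simp
qed

section \<open>The symbol\<close>

lemma borel_measurable_Phi_norm [measurable]:
  "(\<lambda>y::'a::euclidean_space. Phi m \<alpha> ((norm y)\<^sup>2)) \<in> borel_measurable borel"
  unfolding Phi_def by measurable

context
  fixes m \<alpha> :: real
  assumes \<alpha>: "0 < \<alpha>" "\<alpha> < 2" and m: "0 \<le> m"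
begin

lemma Phi_nonneg:
  assumes "0 \<le> z"
  shows "0 \<le> Phi m \<alpha> z"
proof -
  have "(m powr (2 / \<alpha>)) powr (\<alpha> / 2) \<le> (z + m powr (2 / \<alpha>)) powr (\<alpha> / 2)"
    using \<alpha> assms by (intro powr_mono2) auto
  then show ?thesis using \<alpha> m by (simp add: Phi_def powr_powr)
qed

lemma Phi_ge:
  assumes "0 \<le> z"
  shows "z powr (\<alpha> / 2) - m \<le> Phi m \<alpha> z"
  unfolding Phi_def using \<alpha> assms by (intro diff_right_mono powr_mono2) auto

text \<open>This inverse formula makes a Gaussian in \<open>y\<close> a function of the symbol, and
  so accessible to approximation by polynomials in the exponential of minus the symbol.\<close>

lemma Phi_inverse:
  assumes "0 \<le> z"
  shows "(Phi m \<alpha> z + m) powr (2 / \<alpha>) - m powr (2 / \<alpha>) = z"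
  using \<alpha> assms by (simp add: Phi_def powr_powr)

lemma continuous_on_Phi: "continuous_on {0..} (Phi m \<alpha>)"
  unfolding Phi_def using \<alpha> by (intro continuous_intros continuous_on_powr') auto

lemma filterlim_Phi: "filterlim (Phi m \<alpha>) at_top at_top"
proof (rule filterlim_at_top_mono)
  show "filterlim (\<lambda>z. z powr (\<alpha> / 2) - m) at_top at_top"
    using \<alpha> by real_asymp
  show "eventually (\<lambda>z. z powr (\<alpha> / 2) - m \<le> Phi m \<alpha> z) at_top"
    using eventually_ge_at_top[of 0] by eventually_elim (rule Phi_ge)
qed

end

lemma exp_Phi_tendsto_0:
  assumes "0 < \<alpha>" "\<alpha> < 2" "0 \<le> m" "0 < t"
  shows "((\<lambda>z. exp (- t * Phi m \<alpha> z)) \<longlongrightarrow> 0) at_top"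
proof -
  have "filterlim (\<lambda>z. t * Phi m \<alpha> z) at_top at_top"
    by (rule filterlim_tendsto_pos_mult_at_top[OF tendsto_const])
       (use assms filterlim_Phi in auto)
  then have "filterlim (\<lambda>z. - t * Phi m \<alpha> z) at_bot at_top"
    by (simp add: filterlim_uminus_at_top)
  then show ?thesis by (rule filterlim_compose[OF exp_at_bot])
qed

text \<open>Since \<open>\<alpha> < 2\<close>, the exponent \<open>2 / \<alpha>\<close> exceeds 1,
  so the power dominates the linear term \<open>w\<close>.\<close>

lemma exp_inverse_Phi_tendsto_0:
  assumes "0 < \<alpha>" "\<alpha> < 2" "0 \<le> m"
  shows "((\<lambda>w. exp (w - ((w + m) powr (2 / \<alpha>) - m powr (2 / \<alpha>)))) \<longlongrightarrow> (0::real)) at_top"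
proof -
  define p where "p = 2 / \<alpha>"
  have "1 < p" using assms by (simp add: p_def)
  then have "((\<lambda>w. exp (w - ((w + m) powr p - m powr p))) \<longlongrightarrow> 0) at_top"
    by real_asymp
  then show ?thesis by (simp add: p_def)
qed

section \<open>Integrability of the multipliers\<close>

lemma integrable_inverse_1_plus_square: "integrable lborel (\<lambda>t::real. 1 / (1 + t\<^sup>2))"
proof -
  let ?h = "\<lambda>t::real. indicator {0<..} t *\<^sub>R (1 / (1 + t\<^sup>2))"
  have 1: "integrable lborel ?h"
    using integrable_I0i_1_div_plus_square
    by (simp add: interval_lebesgue_integrable_def set_integrable_def einterval_def zero_ereal_def
        greaterThan_def)
  have "integrable lborel (\<lambda>t. ?h (0 + (-1) * t))"
    by (rule lborel_integrable_real_affine[OF 1]) simp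
  with 1 have "integrable lborel (\<lambda>t. ?h t + ?h (0 + (-1) * t))"
    by (rule Bochner_Integration.integrable_add)
  \<comment> \<open>The half-line function and its reflection sum to the integrand everywhere except
    at the point 0, a null set.\<close>
  then show ?thesis
    by (rule integrable_cong_AE_imp)
       (use AE_lborel_singleton[of 0] in \<open>auto elim!: eventually_mono simp: indicator_def not_less\<close>)
qed

text \<open>The function decays faster than \<open>1 / (1 + t\<^sup>2)\<close> beyond some
  \<open>T\<close>; the constant \<open>B\<close> absorbs the bounded range.\<close>

lemma integrable_exp_abs_powr:
  fixes a c :: real
  assumes "0 < a" "0 < c"
  shows "integrable lborel (\<lambda>t. exp (- c * \<bar>t\<bar> powr a))"
proof -
  let ?k = "\<lambda>t::real. exp (- c * t powr a) * (1 + t\<^sup>2)"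
  have "(?k \<longlongrightarrow> 0) at_top" using assms by real_asymp
  then have "eventually (\<lambda>t. ?k t < 1) at_top" by (rule order_tendstoD) simp
  then obtain T where T: "\<And>t. t \<ge> T \<Longrightarrow> ?k t \<le> 1"
    unfolding eventually_at_top_linorder by force
  define B where "B = 1 + (max T 0)\<^sup>2"
  have B: "exp (- c * \<bar>t\<bar> powr a) \<le> B * (1 / (1 + t\<^sup>2))" for t
  proof (cases "\<bar>t\<bar> \<ge> T")
    case True
    then have "exp (- c * \<bar>t\<bar> powr a) * (1 + t\<^sup>2) \<le> 1" using T[of "\<bar>t\<bar>"] by simp
    also have "1 \<le> B" by (simp add: B_def)
    finally show ?thesis by (simp add: field_simps add_pos_nonneg)
  next
    case False
    then have "\<bar>t\<bar>\<^sup>2 \<le> (max T 0)\<^sup>2" by (intro power_mono) auto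
    then have "1 + t\<^sup>2 \<le> B" by (simp add: B_def)
    moreover have "exp (- c * \<bar>t\<bar> powr a) * (1 + t\<^sup>2) \<le> 1 * (1 + t\<^sup>2)"
      using assms by (intro mult_right_mono) auto
    ultimately show ?thesis by (simp add: field_simps add_pos_nonneg)
  qed
  have "norm (exp (- c * \<bar>t\<bar> powr a)) \<le> norm (B * (1 / (1 + t\<^sup>2)))" for t
    unfolding real_norm_def abs_exp_cancel by (rule order_trans[OF B abs_ge_self])
  then show ?thesis
    by (intro Bochner_Integration.integrable_bound[OF integrable_mult_right[OF integrable_inverse_1_plus_square, of B]])
       auto
qed

text \<open>Each coordinate is at most the norm. Sharing \<open>c\<close> equally among the
  coordinates therefore bounds the function by a product of one-dimensional integrable ones.\<close>

lemma integrable_exp_norm_powr: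
  fixes a c :: real
  assumes "0 < a" "0 < c"
  shows "integrable lborel (\<lambda>y::'a::euclidean_space. exp (- c * norm y powr a))"
proof -
  let ?d = "real DIM('a)"
  have "integrable lborel (\<lambda>y::'a. \<Prod>b\<in>Basis. exp (- (c / ?d) * \<bar>y \<bullet> b\<bar> powr a))"
    by (rule lborel_integrable_prod) (intro integrable_exp_abs_powr, use assms in auto)
  then show ?thesis
  proof (rule Bochner_Integration.integrable_bound)
    show "AE y::'a in lborel. norm (exp (- c * norm y powr a))
        \<le> norm (\<Prod>b\<in>Basis. exp (- (c / ?d) * \<bar>y \<bullet> b\<bar> powr a))"
    proof (rule AE_I2)
      fix y :: 'a
      have "(\<Sum>b\<in>Basis. \<bar>y \<bullet> b\<bar> powr a) \<le> (\<Sum>b\<in>(Basis::'a set). norm y powr a)"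
        using assms by (intro sum_mono powr_mono2) (auto simp: Basis_le_norm)
      then have "(c / ?d) * (\<Sum>b\<in>Basis. \<bar>y \<bullet> b\<bar> powr a) \<le> (c / ?d) * (?d * norm y powr a)"
        using assms by (intro mult_left_mono) auto
      then have "exp (- c * norm y powr a) \<le> exp (\<Sum>b\<in>Basis. - (c / ?d) * \<bar>y \<bullet> b\<bar> powr a)"
        by (simp add: sum_distrib_left sum_negf)
      also have "\<dots> = (\<Prod>b\<in>Basis. exp (- (c / ?d) * \<bar>y \<bullet> b\<bar> powr a))"
        by (simp add: exp_sum)
      finally show "norm (exp (- c * norm y powr a))
        \<le> norm (\<Prod>b\<in>Basis. exp (- (c / ?d) * \<bar>y \<bullet> b\<bar> powr a))" by simp
    qed
  qed measurable
qed

text \<open>The symbol at \<open>(norm y)\<^sup>2\<close> is at least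
  \<open>norm y powr \<alpha> - m\<close>, which gives the majorant with constant
  \<open>exp (t * m)\<close>.\<close>

lemma integrable_exp_Phi:
  assumes "0 < \<alpha>" "\<alpha> < 2" "0 \<le> m" "0 < t"
  shows "integrable lborel (\<lambda>y::'a::euclidean_space. exp (- t * Phi m \<alpha> ((norm y)\<^sup>2)))"
proof -
  have "integrable lborel (\<lambda>y::'a. exp (t * m) * exp (- t * norm y powr \<alpha>))"
    using assms by (intro integrable_mult_right integrable_exp_norm_powr)
  then show ?thesis
  proof (rule Bochner_Integration.integrable_bound)
    show "AE y::'a in lborel. norm (exp (- t * Phi m \<alpha> ((norm y)\<^sup>2))) \<le> norm (exp (t * m) * exp (- t * norm y powr \<alpha>))"
    proof (rule AE_I2)
      fix y :: 'a
      have "((norm y)\<^sup>2) powr (\<alpha> / 2) = norm y powr \<alpha>"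
        by (cases "y = 0") (auto simp: powr_powr powr_numeral[symmetric] simp del: powr_numeral)
      then have "norm y powr \<alpha> - m \<le> Phi m \<alpha> ((norm y)\<^sup>2)"
        using Phi_ge[OF assms(1-3), of "(norm y)\<^sup>2"] by simp
      then have "t * (norm y powr \<alpha> - m) \<le> t * Phi m \<alpha> ((norm y)\<^sup>2)"
        using assms by (intro mult_left_mono) auto
      then show "norm (exp (- t * Phi m \<alpha> ((norm y)\<^sup>2))) \<le> norm (exp (t * m) * exp (- t * norm y powr \<alpha>))"
        by (simp add: right_diff_distrib flip: exp_add)
    qed
  qed measurable
qed

section \<open>Inversion for multipliers\<close>

definition modulated_gaussian :: "real \<Rightarrow> 'a::euclidean_space \<Rightarrow> 'a \<Rightarrow> complex" where
  "modulated_gaussian s b y = cis (y \<bullet> b) * of_real (exp (- s * (norm y)\<^sup>2))"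

text \<open>With the unitary normalisation of the transform this is
  \<open>(2 * pi) powr (DIM('a) / 2)\<close> times the Gauss-Weierstrass kernel at time
  \<open>s\<close>; its total mass is that factor instead of 1.\<close>

definition heat_kernel :: "real \<Rightarrow> 'a::euclidean_space \<Rightarrow> 'a \<Rightarrow> real" where
  "heat_kernel s b x = (2 * s) powr - (DIM('a) / 2) * exp (- (norm (x - b))\<^sup>2 / (4 * s))"

lemma borel_measurable_modulated_gaussian [measurable]:
  "modulated_gaussian s b \<in> borel_measurable borel"
  unfolding modulated_gaussian_def by measurable

lemma borel_measurable_heat_kernel [measurable]:
  "heat_kernel s b \<in> borel_measurable borel"
  unfolding heat_kernel_def by measurable

lemma norm_modulated_gaussian: "norm (modulated_gaussian s b y) = exp (- s * (norm y)\<^sup>2)"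
  by (simp add: modulated_gaussian_def norm_mult)

text \<open>The family of test functions is stable under multiplication by centred Gaussians, so
  Laplace moments against one test function are pairings with other test functions.\<close>

lemma modulated_gaussian_mult_exp:
  "modulated_gaussian s b y * of_real (exp (- t * (norm y)\<^sup>2)) = modulated_gaussian (s + t) b y"
  unfolding modulated_gaussian_def mult.assoc of_real_mult[symmetric] exp_add[symmetric]
  by (simp add: algebra_simps)

lemma fourier_integral_modulated_gaussian:
  "0 < s \<Longrightarrow> fourier_integral (modulated_gaussian s b) = (\<lambda>x. of_real (heat_kernel s b x))"
  unfolding modulated_gaussian_def heat_kernel_def by (intro ext fourier_integral_cis_gaussian)

lemma integrable_modulated_gaussian:
  assumes "0 < s"
  shows "integrable lborel (modulated_gaussian s (b::'a::euclidean_space))"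
  by (rule Bochner_Integration.integrable_bound[OF integrable_gaussian[OF assms]])
     (simp_all add: norm_modulated_gaussian)

lemma square_integrable_modulated_gaussian:
  assumes "0 < s"
  shows "square_integrable (modulated_gaussian s (b::'a::euclidean_space))"
proof -
  have "(norm (modulated_gaussian s b y))\<^sup>2 = exp (- (2 * s) * (norm y)\<^sup>2)" for y
    by (simp add: norm_modulated_gaussian power2_eq_square flip: exp_add)
  moreover have "integrable lborel (\<lambda>y::'a. exp (- (2 * s) * (norm y)\<^sup>2))"
    using assms by (intro integrable_gaussian) simp
  ultimately show ?thesis by (simp add: square_integrable_def)
qed

lemma square_integrable_heat_kernel:
  assumes "0 < s"
  shows "square_integrable (\<lambda>x. complex_of_real (heat_kernel s (b::'a::euclidean_space) x))"
proof -
  let ?c = "((2 * s) powr - (DIM('a) / 2))\<^sup>2"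
  let ?g = "\<lambda>y::'a. exp (- (1 / (2 * s)) * (norm y)\<^sup>2)"
  have "integrable (distr lborel borel ((+) (- b))) ?g"
    unfolding lborel_distr_plus using assms by (intro integrable_gaussian) auto
  then have "integrable lborel (\<lambda>x. ?c * ?g (- b + x))"
    by (subst (asm) integrable_distr_eq) auto
  moreover have "(norm (complex_of_real (heat_kernel s b x)))\<^sup>2 = ?c * ?g (- b + x)" for x
  proof -
    have "(exp (- (norm (x - b))\<^sup>2 / (4 * s)))\<^sup>2 = ?g (- b + x)"
      using assms by (simp add: power2_eq_square[of "exp _"] field_simps flip: exp_add)
    then show ?thesis unfolding norm_of_real power2_abs heat_kernel_def power_mult_distrib by simp
  qed
  ultimately show ?thesis unfolding square_integrable_def by simp
qed

lemma lborel_integral_affine: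
  fixes F :: "'a::euclidean_space \<Rightarrow> 'b::{banach, second_countable_topology}"
  assumes [measurable]: "F \<in> borel_measurable borel" and c: "0 < c"
  shows "(\<integral>x. F x \<partial>lborel) = c ^ DIM('a) *\<^sub>R (\<integral>w. F (b + c *\<^sub>R w) \<partial>lborel)"
proof -
  have "(\<integral>x. F x \<partial>lborel) = (\<integral>x. F x \<partial>density (distr lborel borel (\<lambda>x. b + c *\<^sub>R x)) (\<lambda>_. ennreal (c ^ DIM('a))))"
    using lborel_affine[of c b] c by simp
  also have "\<dots> = c ^ DIM('a) *\<^sub>R (\<integral>w. F (b + c *\<^sub>R w) \<partial>lborel)"
    using c by (subst integral_density) (auto simp: integral_distr)
  finally show ?thesis .
qed

text \<open>An approximate identity: the substitution \<open>x = b + c k *\<^sub>R w\<close> fixes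
  the Gaussian and moves the dependence on \<open>k\<close> into \<open>g\<close>, where dominated
  convergence applies. The time is a square so that the spatial scale \<open>c k\<close> involves no
  root.\<close>

lemma integral_heat_kernel_tendsto:
  fixes g :: "'a::euclidean_space \<Rightarrow> complex"
  assumes meas [measurable]: "g \<in> borel_measurable borel" and bdd: "\<And>x. norm (g x) \<le> B"
    and cont: "isCont g b"
  shows "(\<lambda>k. \<integral>x. g x * of_real (heat_kernel ((1 / real (Suc k))\<^sup>2) b x) \<partial>lborel)
     \<longlonglongrightarrow> of_real ((2 * pi) powr (DIM('a) / 2)) * g b"
proof -
  define K :: real where "K = 2 powr - (DIM('a) / 2)"
  let ?e = "\<lambda>w::'a. exp (- (1 / 4) * (norm w)\<^sup>2)"
  define c where "c k = 1 / real (Suc k)" for k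
  have c: "c k > 0" for k by (simp add: c_def)
  have c0: "c \<longlonglongrightarrow> 0" unfolding c_def by (rule LIMSEQ_Suc[OF lim_1_over_n])
  have int: "(\<integral>x. g x * of_real (heat_kernel ((c k)\<^sup>2) b x) \<partial>lborel)
     = of_real K * (\<integral>w. g (b + c k *\<^sub>R w) * of_real (?e w) \<partial>lborel)" for k
  proof -
    have 1: "heat_kernel ((c k)\<^sup>2) b (b + c k *\<^sub>R w) = (2 * (c k)\<^sup>2) powr - (DIM('a) / 2) * ?e w" for w
      using c[of k] by (simp add: heat_kernel_def power_mult_distrib)
    \<comment> \<open>The Jacobian cancels the scale in the prefactor of the kernel, leaving a
      constant independent of \<open>k\<close>.\<close>
    have 2: "c k ^ DIM('a) * (2 * (c k)\<^sup>2) powr - (DIM('a) / 2) = K"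
    proof -
      have "((c k)\<^sup>2) powr (DIM('a) / 2) = c k ^ DIM('a)"
        using c[of k] by (simp add: powr_powr flip: powr_realpow powr_numeral)
      then show ?thesis
        using c[of k] by (simp add: K_def powr_mult powr_minus field_simps)
    qed
    have "(\<integral>x. g x * of_real (heat_kernel ((c k)\<^sup>2) b x) \<partial>lborel)
      = c k ^ DIM('a) *\<^sub>R (\<integral>w. of_real ((2 * (c k)\<^sup>2) powr - (DIM('a) / 2)) * (g (b + c k *\<^sub>R w) * of_real (?e w)) \<partial>lborel)"
      by (subst lborel_integral_affine[OF _ c[of k], of _ b]) (simp_all only: 1 of_real_mult mult_ac, measurable)
    also have "\<dots> = of_real (c k ^ DIM('a) * (2 * (c k)\<^sup>2) powr - (DIM('a) / 2)) * (\<integral>w. g (b + c k *\<^sub>R w) * of_real (?e w) \<partial>lborel)"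
      by (simp add: scaleR_conv_of_real)
    finally show ?thesis unfolding 2 .
  qed
  have "(\<lambda>k. \<integral>w. g (b + c k *\<^sub>R w) * of_real (?e w) \<partial>lborel) \<longlonglongrightarrow> (\<integral>w. g b * of_real (?e w) \<partial>lborel)"
  proof (rule integral_dominated_convergence[where w="\<lambda>w. B * ?e w"])
    show "integrable lborel (\<lambda>w. B * ?e w)"
      by (intro integrable_mult_right integrable_gaussian) simp
    show "AE w in lborel. norm (g (b + c k *\<^sub>R w) * of_real (?e w)) \<le> B * ?e w" for k
      by (rule AE_I2) (simp add: norm_mult bdd mult_right_mono)
    show "AE w in lborel. (\<lambda>k. g (b + c k *\<^sub>R w) * of_real (?e w)) \<longlonglongrightarrow> g b * of_real (?e w)"
    proof (rule AE_I2)
      fix w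
      have "(\<lambda>k. b + c k *\<^sub>R w) \<longlonglongrightarrow> b + 0 *\<^sub>R w" by (intro tendsto_intros c0)
      then have "(\<lambda>k. g (b + c k *\<^sub>R w)) \<longlonglongrightarrow> g b"
        by (intro isCont_tendsto_compose[OF cont]) simp
      then show "(\<lambda>k. g (b + c k *\<^sub>R w) * of_real (?e w)) \<longlonglongrightarrow> g b * of_real (?e w)"
        by (intro tendsto_intros)
    qed
  qed measurable
  moreover have "(\<integral>w. g b * of_real (?e w) \<partial>lborel) = g b * of_real ((4 * pi) powr (DIM('a) / 2))"
    using integral_cis_gaussian[of "1/4" "0::'a"] by (simp add: mult.commute)
  ultimately have "(\<lambda>k. of_real K * (\<integral>w. g (b + c k *\<^sub>R w) * of_real (?e w) \<partial>lborel))
     \<longlonglongrightarrow> of_real K * (g b * of_real ((4 * pi) powr (DIM('a) / 2)))"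
    by (intro tendsto_mult_left) (simp only:)
  moreover have "K * (4 * pi) powr (DIM('a) / 2) = (2 * pi) powr (DIM('a) / 2)"
  proof -
    have "(4 * pi) powr (DIM('a) / 2) = 2 powr (DIM('a) / 2) * (2 * pi) powr (DIM('a) / 2)"
      by (simp flip: powr_mult)
    then show ?thesis by (simp add: K_def powr_minus)
  qed
  then have "of_real K * (g b * of_real ((4 * pi) powr (DIM('a) / 2))) = of_real ((2 * pi) powr (DIM('a) / 2)) * g b"
    by (metis mult.assoc mult.commute of_real_mult)
  ultimately show ?thesis
    unfolding int[unfolded c_def] c_def by simp
qed

context
  fixes f F g :: "'a::euclidean_space \<Rightarrow> complex" and \<phi> :: "real \<Rightarrow> real"
  assumes f: "integrable lborel f"
    and fF: "has_fourier_transform f F"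
    and g\<phi>F: "has_fourier_transform g (\<lambda>y. of_real (\<phi> ((norm y)\<^sup>2)) * F y)"
    and \<phi>: "continuous_on {0..} \<phi>" "(\<phi> \<longlongrightarrow> 0) at_top" "\<And>z. 0 \<le> z \<Longrightarrow> \<bar>\<phi> z\<bar> \<le> 1"
    and [measurable]: "(\<lambda>y::'a. \<phi> ((norm y)\<^sup>2)) \<in> borel_measurable borel"
begin

text \<open>The \<open>F\<close> witnessing the semigroup relation may vary with time. It agrees with the Fourier
  integral of \<open>f\<close> against all Gaussians, hence, by approximation of \<open>\<phi>\<close> by polynomials in
  \<open>exp (-|y|\<^sup>2)\<close>, also after multiplication with \<open>\<phi>\<close>; this avoids the Plancherel theorem.\<close>

lemma multiplier_integral_heat_kernel:
  assumes s: "0 < s"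
  shows "(\<integral>x. g x * of_real (heat_kernel s b x) \<partial>lborel)
     = (\<integral>y. fourier_integral f y * of_real (\<phi> ((norm y)\<^sup>2)) * modulated_gaussian s b y \<partial>lborel)"
proof -
  have F: "square_integrable F" using fF by (simp add: has_fourier_transform_def)
  then have [measurable]: "F \<in> borel_measurable borel" by (simp add: square_integrable_def)
  have [measurable]: "f \<in> borel_measurable borel" using f by auto
  have [measurable]: "fourier_integral f \<in> borel_measurable borel"
    by (rule borel_measurable_fourier_integral) simp
  let ?G = "modulated_gaussian s b"
  \<comment> \<open>Both sides equal the integral of \<open>f\<close> against the heat kernel: one
    by the L2 pairing, the other by the multiplication formula.\<close>
  have pair: "(\<integral>y. F y * modulated_gaussian r b y \<partial>lborel)
      = (\<integral>y. fourier_integral f y * modulated_gaussian r b y \<partial>lborel)" if r: "0 < r" for r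
    using has_fourier_transform_pairing[OF fF integrable_modulated_gaussian[OF r] square_integrable_modulated_gaussian[OF r], of b]
      fourier_multiplication_formula[OF f integrable_modulated_gaussian[OF r], of b]
      square_integrable_heat_kernel[OF r, of b]
    by (simp add: fourier_integral_modulated_gaussian[OF r])
  have iF: "integrable lborel (\<lambda>y. F y * modulated_gaussian r b y)" if "0 < r" for r
    by (rule square_integrable_mult_integrable[OF F square_integrable_modulated_gaussian[OF that]])
  have if': "integrable lborel (\<lambda>y. fourier_integral f y * modulated_gaussian r b y)" if "0 < r" for r
  proof -
    let ?C = "(2 * pi) powr (- (DIM('a) / 2)) * (\<integral>x. norm (f x) \<partial>lborel)"
    have "integrable lborel (\<lambda>y. of_real ?C * modulated_gaussian r b y)"
      by (intro integrable_mult_right integrable_modulated_gaussian that)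
    then show ?thesis
    proof (rule Bochner_Integration.integrable_bound)
      show "AE y in lborel. norm (fourier_integral f y * modulated_gaussian r b y) \<le> norm (of_real ?C * modulated_gaussian r b y)"
      proof (rule AE_I2)
        fix y
        have "norm (fourier_integral f y) \<le> norm (complex_of_real ?C)"
          using norm_fourier_integral_le[of f y] by (simp add: norm_mult)
        then show "norm (fourier_integral f y * modulated_gaussian r b y) \<le> norm (of_real ?C * modulated_gaussian r b y)"
          unfolding norm_mult by (intro mult_right_mono) auto
      qed
    qed measurable
  qed
  \<comment> \<open>The Gaussian weight is what makes this integrable: \<open>F\<close> is known
    only to be square integrable and the Fourier integral only to be bounded.\<close>
  let ?D = "\<lambda>y. (F y - fourier_integral f y) * ?G y"
  have D: "integrable lborel ?D"
    unfolding left_diff_distrib by (intro Bochner_Integration.integrable_diff iF if' s)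
  \<comment> \<open>The extra exponential shifts the Gaussian parameter from \<open>s\<close> to
    \<open>s + real j\<close>, where \<open>pair\<close> applies again.\<close>
  have zero: "(\<integral>y. ?D y * of_real (exp (- real j * (norm y)\<^sup>2)) \<partial>lborel) = 0" for j
  proof -
    have r: "0 < s + real j" using s by simp
    have "(\<integral>y. ?D y * of_real (exp (- real j * (norm y)\<^sup>2)) \<partial>lborel)
      = (\<integral>y. F y * modulated_gaussian (s + real j) b y - fourier_integral f y * modulated_gaussian (s + real j) b y \<partial>lborel)"
      unfolding mult.assoc modulated_gaussian_mult_exp left_diff_distrib ..
    also have "\<dots> = 0"
      using pair[OF r] iF[OF r] if'[OF r] by simp
    finally show ?thesis .
  qed
  have "(\<integral>y. ?D y * of_real (\<phi> ((norm y)\<^sup>2)) \<partial>lborel) = 0"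
    by (rule laplace_zero_imp_integral_zero[OF D _ _ zero \<phi>(1,2)]) auto
  moreover have "integrable lborel (\<lambda>y. (of_real (\<phi> ((norm y)\<^sup>2)) * F y) * ?G y)"
    using g\<phi>F s by (intro square_integrable_mult_integrable square_integrable_modulated_gaussian)
      (simp_all add: has_fourier_transform_def)
  moreover have "integrable lborel (\<lambda>y. ?D y * of_real (\<phi> ((norm y)\<^sup>2)))"
    by (rule Bochner_Integration.integrable_bound[OF D])
       (auto simp: norm_mult intro!: mult_right_le_one_le \<phi>(3))
  moreover have "(\<lambda>y. fourier_integral f y * of_real (\<phi> ((norm y)\<^sup>2)) * ?G y)
     = (\<lambda>y. (of_real (\<phi> ((norm y)\<^sup>2)) * F y) * ?G y - ?D y * of_real (\<phi> ((norm y)\<^sup>2)))"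
    by (auto simp: algebra_simps)
  ultimately have "(\<integral>y. fourier_integral f y * of_real (\<phi> ((norm y)\<^sup>2)) * ?G y \<partial>lborel)
     = (\<integral>y. (of_real (\<phi> ((norm y)\<^sup>2)) * F y) * ?G y \<partial>lborel)"
    by simp
  also have "\<dots> = (\<integral>x. g x * of_real (heat_kernel s b x) \<partial>lborel)"
    using has_fourier_transform_pairing[OF g\<phi>F integrable_modulated_gaussian[OF s] square_integrable_modulated_gaussian[OF s], of b]
      square_integrable_heat_kernel[OF s, of b]
    by (simp add: fourier_integral_modulated_gaussian[OF s])
  finally show ?thesis by simp
qed

text \<open>Let \<open>s\<close> tend to 0 in the preceding identity. The left side is an
  approximate identity at \<open>b\<close>, the right side is dominated by a multiple of the
  multiplier. Continuity of \<open>g\<close> at \<open>b\<close> is what yields a point value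
  instead of an almost everywhere statement.\<close>

lemma multiplier_eq_fourier_inverse:
  assumes int: "integrable lborel (\<lambda>y::'a. \<phi> ((norm y)\<^sup>2))"
    and bdd: "\<And>x. norm (g x) \<le> B" and cont: "isCont g b"
  shows "of_real ((2 * pi) powr (DIM('a) / 2)) * g b
     = (\<integral>y. fourier_integral f y * of_real (\<phi> ((norm y)\<^sup>2)) * cis (y \<bullet> b) \<partial>lborel)"
proof (rule LIMSEQ_unique)
  have [measurable]: "g \<in> borel_measurable borel"
    using g\<phi>F by (simp add: has_fourier_transform_def square_integrable_def)
  show "(\<lambda>k. \<integral>x. g x * of_real (heat_kernel ((1 / real (Suc k))\<^sup>2) b x) \<partial>lborel)
     \<longlonglongrightarrow> of_real ((2 * pi) powr (DIM('a) / 2)) * g b"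
    by (rule integral_heat_kernel_tendsto[OF _ bdd cont]) simp
  have [measurable]: "f \<in> borel_measurable borel" using f by auto
  have [measurable]: "fourier_integral f \<in> borel_measurable borel"
    by (rule borel_measurable_fourier_integral) simp
  let ?C = "(2 * pi) powr (- (DIM('a) / 2)) * (\<integral>x. norm (f x) \<partial>lborel)"
  let ?h = "\<lambda>y. fourier_integral f y * of_real (\<phi> ((norm y)\<^sup>2))"
  have "(\<lambda>k. \<integral>y. ?h y * modulated_gaussian ((1 / real (Suc k))\<^sup>2) b y \<partial>lborel)
     \<longlonglongrightarrow> (\<integral>y. ?h y * cis (y \<bullet> b) \<partial>lborel)"
  proof (rule integral_dominated_convergence[where w="\<lambda>y. ?C * \<bar>\<phi> ((norm y)\<^sup>2)\<bar>"])
    show "integrable lborel (\<lambda>y::'a. ?C * \<bar>\<phi> ((norm y)\<^sup>2)\<bar>)"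
      using int by (intro integrable_mult_right integrable_abs)
    show "AE y in lborel. norm (?h y * modulated_gaussian ((1 / real (Suc k))\<^sup>2) b y) \<le> ?C * \<bar>\<phi> ((norm y)\<^sup>2)\<bar>" for k
    proof (rule AE_I2)
      fix y
      have "norm (modulated_gaussian ((1 / real (Suc k))\<^sup>2) b y) \<le> 1"
        by (simp add: norm_modulated_gaussian)
      moreover have "norm (?h y) \<le> ?C * \<bar>\<phi> ((norm y)\<^sup>2)\<bar>"
        using norm_fourier_integral_le[of f y] by (simp add: norm_mult mult_right_mono)
      ultimately have "norm (?h y) * norm (modulated_gaussian ((1 / real (Suc k))\<^sup>2) b y) \<le> (?C * \<bar>\<phi> ((norm y)\<^sup>2)\<bar>) * 1"
        by (intro mult_mono) auto
      then show "norm (?h y * modulated_gaussian ((1 / real (Suc k))\<^sup>2) b y) \<le> ?C * \<bar>\<phi> ((norm y)\<^sup>2)\<bar>"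
        by (simp add: norm_mult)
    qed
    show "AE y in lborel. (\<lambda>k. ?h y * modulated_gaussian ((1 / real (Suc k))\<^sup>2) b y) \<longlonglongrightarrow> ?h y * cis (y \<bullet> b)"
    proof (rule AE_I2)
      fix y
      have "(\<lambda>k. 1 / real (Suc k)) \<longlonglongrightarrow> 0" by (rule LIMSEQ_Suc[OF lim_1_over_n])
      then have "(\<lambda>k. ?h y * (cis (y \<bullet> b) * of_real (exp (- ((1 / real (Suc k))\<^sup>2) * (norm y)\<^sup>2))))
         \<longlonglongrightarrow> ?h y * (cis (y \<bullet> b) * of_real (exp (- (0\<^sup>2) * (norm y)\<^sup>2)))"
        by (intro tendsto_intros)
      then show "(\<lambda>k. ?h y * modulated_gaussian ((1 / real (Suc k))\<^sup>2) b y) \<longlonglongrightarrow> ?h y * cis (y \<bullet> b)"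
        by (simp add: modulated_gaussian_def)
    qed
  qed measurable
  then show "(\<lambda>k. \<integral>x. g x * of_real (heat_kernel ((1 / real (Suc k))\<^sup>2) b x) \<partial>lborel)
     \<longlonglongrightarrow> (\<integral>y. ?h y * cis (y \<bullet> b) \<partial>lborel)"
    by (subst multiplier_integral_heat_kernel) simp_all
qed

end

section \<open>Positivity of the transition probabilities\<close>

text \<open>A test function positive exactly on the ball of radius \<open>r\<close>. Being
  Lipschitz, it has averages that depend continuously on the starting point, unlike what an
  indicator would give directly.\<close>

definition tent :: "real \<Rightarrow> 'a::euclidean_space \<Rightarrow> real" where
  "tent r x = max 0 (r - norm x)"

lemma borel_measurable_tent [measurable]: "tent r \<in> borel_measurable borel"
  unfolding tent_def by measurable

lemma tent_nonneg: "0 \<le> tent r x"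
  by (simp add: tent_def)

lemma tent_le_indicator:
  assumes "0 < r"
  shows "tent r x \<le> r * indicator (ball 0 r) x"
  using assms by (auto simp: tent_def indicator_def)

lemma tent_lipschitz: "\<bar>tent r x - tent r y\<bar> \<le> norm (x - y)"
  using norm_triangle_ineq3[of x y] by (auto simp: tent_def)

lemma integrable_tent:
  assumes "0 < r"
  shows "integrable lborel (tent r :: 'a::euclidean_space \<Rightarrow> real)"
    and "square_integrable (\<lambda>x::'a. complex_of_real (tent r x))"
proof -
  have ind: "integrable lborel (\<lambda>x::'a. c * indicator (ball 0 r) x :: real)" for c
    by (intro integrable_mult_right integrable_real_indicator) (use emeasure_lborel_ball_finite[of "0::'a" r] in auto)
  show "integrable lborel (tent r :: 'a \<Rightarrow> real)"
    by (rule Bochner_Integration.integrable_bound[OF ind[of r]])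
       (use assms in \<open>auto simp: tent_def indicator_def\<close>)
  have "(tent r x)\<^sup>2 \<le> r\<^sup>2 * indicator (ball 0 r) x" for x :: 'a
    using assms by (auto simp: tent_def indicator_def intro!: power_mono)
  then have "integrable lborel (\<lambda>x::'a. (tent r x)\<^sup>2)"
    by (intro Bochner_Integration.integrable_bound[OF ind[of "r\<^sup>2"]]) auto
  then show "square_integrable (\<lambda>x::'a. complex_of_real (tent r x))"
    by (simp add: square_integrable_def)
qed

text \<open>No process occurs here, so the time \<open>n\<close> and the size of the integral depend
  only on the parameters and \<open>b\<close>. This is what makes the final constant independent of
  the process.\<close>

lemma exists_time_nonzero:
  fixes b :: "'a::euclidean_space"
  assumes \<alpha>: "0 < \<alpha>" "\<alpha> < 2" "0 \<le> m" and r: "0 < r"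
  shows "\<exists>n\<ge>1. (\<integral>y. fourier_integral (\<lambda>x. complex_of_real (tent r x)) y
            * of_real (exp (- real n * Phi m \<alpha> ((norm y)\<^sup>2))) * cis (y \<bullet> b) \<partial>lborel) \<noteq> 0"
proof (rule ccontr)
  let ?f = "\<lambda>x::'a. complex_of_real (tent r x)"
  let ?h = "fourier_integral ?f"
  assume "\<not> ?thesis"
  then have Q0: "(\<integral>y. ?h y * of_real (exp (- real n * Phi m \<alpha> ((norm y)\<^sup>2))) * cis (y \<bullet> b) \<partial>lborel) = 0" if "1 \<le> n" for n
    using that by blast
  have f: "integrable lborel ?f"
    using integrable_tent(1)[OF r] by (rule integrable_of_real)
  have [measurable]: "?h \<in> borel_measurable borel"
    by (rule borel_measurable_fourier_integral) simp
  let ?C = "(2 * pi) powr (- (DIM('a) / 2)) * (\<integral>x. norm (?f x) \<partial>lborel)"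
  let ?\<psi> = "\<lambda>y::'a. Phi m \<alpha> ((norm y)\<^sup>2)"
  \<comment> \<open>The factor for time 1 makes \<open>?D\<close> integrable and turns the moment of
    order \<open>j\<close> into the integral at time \<open>Suc j\<close>, so that only times at
    least 1 occur.\<close>
  let ?D = "\<lambda>y. ?h y * of_real (exp (- 1 * ?\<psi> y)) * cis (y \<bullet> b)"
  \<comment> \<open>The term \<open>w\<close> cancels the factor kept in \<open>?D\<close>; the rest
    inverts the symbol, so the product leaves the Gaussian with parameter 1.\<close>
  let ?g = "\<lambda>w. exp (w - ((w + m) powr (2 / \<alpha>) - m powr (2 / \<alpha>)))"
  have D: "integrable lborel ?D"
  proof (rule Bochner_Integration.integrable_bound)
    show "integrable lborel (\<lambda>y. ?C * exp (- 1 * ?\<psi> y))"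
      by (intro integrable_mult_right integrable_exp_Phi \<alpha>) simp
    show "AE y in lborel. norm (?D y) \<le> norm (?C * exp (- 1 * ?\<psi> y))"
    proof (rule AE_I2)
      fix y
      have "norm (?D y) = norm (?h y) * exp (- 1 * ?\<psi> y)" by (simp add: norm_mult)
      also have "\<dots> \<le> ?C * exp (- 1 * ?\<psi> y)"
        by (intro mult_right_mono norm_fourier_integral_le) simp
      finally show "norm (?D y) \<le> norm (?C * exp (- 1 * ?\<psi> y))"
        unfolding real_norm_def by (rule order_trans[OF _ abs_ge_self])
    qed
  qed measurable
  have "(\<integral>y. ?D y * of_real (?g (?\<psi> y)) \<partial>lborel) = 0"
  proof (rule laplace_zero_imp_integral_zero[OF D, where \<psi>="?\<psi>" and g="?g"])
    show "0 \<le> ?\<psi> y" for y by (intro Phi_nonneg \<alpha>) simp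
    show "(\<integral>y. ?D y * of_real (exp (- real j * ?\<psi> y)) \<partial>lborel) = 0" for j
    proof -
      have "?D y * of_real (exp (- real j * ?\<psi> y)) = ?h y * of_real (exp (- real (Suc j) * ?\<psi> y)) * cis (y \<bullet> b)" for y
      proof -
        have "exp (- real (Suc j) * ?\<psi> y) = exp (- 1 * ?\<psi> y) * exp (- real j * ?\<psi> y)"
          unfolding exp_add[symmetric] by (simp add: algebra_simps)
        then show ?thesis by (simp only: of_real_mult mult_ac)
      qed
      then show ?thesis using Q0[of "Suc j"] by (simp only: le_add1 plus_1_eq_Suc)
    qed
    show "continuous_on {0..} ?g"
      using \<alpha> by (intro continuous_intros continuous_on_powr') auto
    show "(?g \<longlongrightarrow> 0) at_top" by (rule exp_inverse_Phi_tendsto_0[OF \<alpha>])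
  qed measurable
  also have "(\<lambda>y. ?D y * of_real (?g (?\<psi> y))) = (\<lambda>y. ?h y * modulated_gaussian 1 b y)"
  proof
    fix y
    have "?g (?\<psi> y) = exp (?\<psi> y) * exp (- (1 * (norm y)\<^sup>2))"
      unfolding Phi_inverse[OF \<alpha> zero_le_power2] by (simp flip: exp_add)
    then have "exp (- 1 * ?\<psi> y) * ?g (?\<psi> y) = exp (- 1 * (norm y)\<^sup>2)"
      by (simp add: exp_minus)
    moreover have "?D y * of_real (?g (?\<psi> y)) = ?h y * (cis (y \<bullet> b) * of_real (exp (- 1 * ?\<psi> y) * ?g (?\<psi> y)))"
      unfolding of_real_mult by (simp only: mult_ac)
    ultimately show "?D y * of_real (?g (?\<psi> y)) = ?h y * modulated_gaussian 1 b y"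
      by (simp only: modulated_gaussian_def)
  qed
  also have "(\<integral>y. ?h y * modulated_gaussian 1 b y \<partial>lborel) = (\<integral>x. ?f x * of_real (heat_kernel 1 b x) \<partial>lborel)"
    using fourier_multiplication_formula[OF f integrable_modulated_gaussian[of 1 b]]
    by (simp add: fourier_integral_modulated_gaussian)
  also have "\<dots> = of_real (\<integral>x. tent r x * heat_kernel 1 b x \<partial>lborel)"
    by (simp flip: of_real_mult)
  finally have zero: "(\<integral>x. tent r x * heat_kernel 1 b x \<partial>lborel) = 0" by simp
  have "integrable lborel (\<lambda>x. tent r x * heat_kernel 1 b x)"
  proof (rule Bochner_Integration.integrable_bound)
    show "integrable lborel (\<lambda>x::'a. 2 powr - (DIM('a) / 2) * tent r x)"
      by (intro integrable_mult_right integrable_tent r)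
    show "AE x in lborel. norm (tent r x * heat_kernel 1 b x) \<le> norm (2 powr - (DIM('a) / 2) * tent r x)"
    proof (rule AE_I2)
      fix x :: 'a
      have "0 \<le> heat_kernel 1 b x" "heat_kernel 1 b x \<le> 2 powr - (DIM('a) / 2)"
        by (auto simp: heat_kernel_def intro!: mult_left_le)
      then have "tent r x * heat_kernel 1 b x \<le> tent r x * 2 powr - (DIM('a) / 2)" "0 \<le> tent r x * heat_kernel 1 b x"
        by (intro mult_left_mono mult_nonneg_nonneg tent_nonneg; simp)+
      then show "norm (tent r x * heat_kernel 1 b x) \<le> norm (2 powr - (DIM('a) / 2) * tent r x)"
        unfolding real_norm_def by (simp only: mult.commute abs_of_nonneg)
    qed
  qed measurable
  \<comment> \<open>The heat kernel is strictly positive, so a vanishing integral would force the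
    tent to vanish almost everywhere and the ball to be a null set.\<close>
  from integral_nonneg_eq_0_iff_AE[OF this] zero
  have "AE x in lborel. tent r x * heat_kernel 1 b x = 0"
    by (auto simp: tent_nonneg heat_kernel_def)
  then have "AE x::'a in lborel. x \<notin> ball 0 r"
    by (rule eventually_mono) (auto simp: tent_def heat_kernel_def)
  then have "ball (0::'a) r \<in> null_sets lborel"
    by (simp add: AE_iff_null_sets)
  then have "measure lborel (ball (0::'a) r) = 0"
    by (simp add: measure_def null_setsD1)
  then show False using content_ball_pos[OF r, of "0::'a"] by simp
qed

section \<open>Transition probabilities of a given process\<close>

context
  fixes m \<alpha> :: real and M :: "'w measure" and X :: "real \<Rightarrow> 'w \<Rightarrow> 'a::euclidean_space"
  assumes \<alpha>: "0 < \<alpha>" "\<alpha> < 2" "0 \<le> m"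
    and X: "relativistic_stable_process m \<alpha> M X"
begin

lemma prob_space_process: "prob_space M"
  using X by (simp add: relativistic_stable_process_def cadlag_levy_process_def)

lemma measurable_process: "0 \<le> t \<Longrightarrow> X t \<in> borel_measurable M"
  using X by (simp add: relativistic_stable_process_def cadlag_levy_process_def)

lemma ball_event:
  assumes "0 \<le> t"
  shows "{\<omega> \<in> space M. x + X t \<omega> \<in> ball c r} \<in> sets M"
proof -
  have "(\<lambda>\<omega>. x + X t \<omega>) -` ball c r \<inter> space M \<in> sets M"
    using measurable_process[OF assms] by (intro measurable_sets[of _ M borel]) auto
  then show ?thesis by (simp add: vimage_def Collect_conj_eq Int_commute)
qed

text \<open>The semigroup relation only identifies the averages as an L2 class. They are bounded and
  Lipschitz in the starting point, so Fourier inversion holds at every \<open>b\<close>.\<close>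

lemma expectation_tent_eq:
  assumes r: "0 < r" and n: "1 \<le> n"
  shows "of_real ((2 * pi) powr (DIM('a) / 2) * (\<integral>\<omega>. tent r (b + X (real n) \<omega>) \<partial>M))
     = (\<integral>y. fourier_integral (\<lambda>x. complex_of_real (tent r x)) y
            * of_real (exp (- real n * Phi m \<alpha> ((norm y)\<^sup>2))) * cis (y \<bullet> b) \<partial>lborel)"
proof -
  interpret prob_space M by (rule prob_space_process)
  let ?f = "\<lambda>x::'a. complex_of_real (tent r x)"
  let ?g = "\<lambda>x. complex_of_real (\<integral>\<omega>. tent r (x + X (real n) \<omega>) \<partial>M)"
  let ?\<phi> = "\<lambda>z. exp (- real n * Phi m \<alpha> z)"
  have [measurable]: "X (real n) \<in> borel_measurable M" by (rule measurable_process) simp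
  have bdd: "\<bar>tent r x\<bar> \<le> r" for x :: 'a using r by (simp add: tent_def)
  have int: "integrable M (\<lambda>\<omega>. tent r (x + X (real n) \<omega>))" for x
    by (rule integrable_const_bound[where B=r]) (auto simp: bdd)
  have "semigroup_L m \<alpha> (real n) ?f (\<lambda>x. expectation_from M X x (\<lambda>p. ?f (p (real n))))"
    using X integrable_tent(2)[OF r, where ?'a='a] unfolding relativistic_stable_process_def by (auto dest: spec[of _ "real n"])
  moreover have "(\<lambda>x. expectation_from M X x (\<lambda>p. ?f (p (real n)))) = ?g"
    by (simp add: expectation_from_def)
  ultimately obtain F where F: "has_fourier_transform ?f F"
      "has_fourier_transform ?g (\<lambda>y. of_real (?\<phi> ((norm y)\<^sup>2)) * F y)"
    unfolding semigroup_L_def neg_laplacian_fun_def by auto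
  have "of_real ((2 * pi) powr (DIM('a) / 2)) * ?g b
     = (\<integral>y. fourier_integral ?f y * of_real (?\<phi> ((norm y)\<^sup>2)) * cis (y \<bullet> b) \<partial>lborel)"
  proof (rule multiplier_eq_fourier_inverse[OF _ F])
    show "integrable lborel ?f"
      using integrable_tent(1)[OF r] by (rule integrable_of_real)
    show "continuous_on {0..} ?\<phi>"
      by (intro continuous_intros continuous_on_Phi \<alpha>)
    show "(?\<phi> \<longlongrightarrow> 0) at_top" by (rule exp_Phi_tendsto_0[OF \<alpha>]) (use n in simp)
    show "\<bar>?\<phi> z\<bar> \<le> 1" if "0 \<le> z" for z
      using Phi_nonneg[OF \<alpha> that] by simp
    show "integrable lborel (\<lambda>y::'a. ?\<phi> ((norm y)\<^sup>2))"
      by (rule integrable_exp_Phi[OF \<alpha>]) (use n in simp)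
    show "norm (?g x) \<le> r" for x
      unfolding norm_of_real
      using order_trans[OF integral_abs_bound[of M "\<lambda>\<omega>. tent r (x + X (real n) \<omega>)"]
        integral_mono[OF integrable_abs[OF int[of x]], of "\<lambda>_. r"]] by (simp add: bdd prob_space)
    \<comment> \<open>Averaging translates of the tent preserves its Lipschitz constant 1;
      continuity at \<open>b\<close> follows.\<close>
    have lip: "\<bar>(\<integral>\<omega>. tent r (x + X (real n) \<omega>) \<partial>M) - (\<integral>\<omega>. tent r (b + X (real n) \<omega>) \<partial>M)\<bar> \<le> norm (x - b)" for x
    proof -
      have "(\<integral>\<omega>. tent r (x + X (real n) \<omega>) \<partial>M) - (\<integral>\<omega>. tent r (b + X (real n) \<omega>) \<partial>M)
         = (\<integral>\<omega>. tent r (x + X (real n) \<omega>) - tent r (b + X (real n) \<omega>) \<partial>M)"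
        using int by simp
      also have "\<bar>\<dots>\<bar> \<le> (\<integral>\<omega>. \<bar>tent r (x + X (real n) \<omega>) - tent r (b + X (real n) \<omega>)\<bar> \<partial>M)"
        by (rule integral_abs_bound)
      also have "\<dots> \<le> (\<integral>\<omega>. norm (x - b) \<partial>M)"
      proof (rule integral_mono)
        show "\<bar>tent r (x + X (real n) \<omega>) - tent r (b + X (real n) \<omega>)\<bar> \<le> norm (x - b)" for \<omega>
          using tent_lipschitz[of r "x + X (real n) \<omega>" "b + X (real n) \<omega>"] by simp
      qed (use int in auto)
      finally show ?thesis by (simp add: prob_space)
    qed
    have "((\<lambda>x. (\<integral>\<omega>. tent r (x + X (real n) \<omega>) \<partial>M) - (\<integral>\<omega>. tent r (b + X (real n) \<omega>) \<partial>M)) \<longlongrightarrow> 0) (at b)"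
    proof (rule Lim_null_comparison)
      show "eventually (\<lambda>x. norm ((\<integral>\<omega>. tent r (x + X (real n) \<omega>) \<partial>M) - (\<integral>\<omega>. tent r (b + X (real n) \<omega>) \<partial>M)) \<le> norm (x - b)) (at b)"
        using lip by (simp add: always_eventually)
      show "((\<lambda>x. norm (x - b)) \<longlongrightarrow> 0) (at b)"
        by (rule tendsto_eq_intros refl | simp)+
    qed
    then show "isCont ?g b"
      unfolding isCont_def by (intro tendsto_of_real) (rule LIM_zero_cancel)
  qed measurable
  then show ?thesis by simp
qed

text \<open>The tent is at most \<open>r\<close> times the indicator of the ball, so the probability
  is at least the expectation of the tent divided by \<open>r\<close>. Taking the norm loses
  nothing, as that expectation is nonnegative.\<close>

lemma prob_ball_ge:
  assumes r: "0 < r" and n: "1 \<le> n"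
  shows "norm (\<integral>y. fourier_integral (\<lambda>x. complex_of_real (tent r x)) y
            * of_real (exp (- real n * Phi m \<alpha> ((norm y)\<^sup>2))) * cis (y \<bullet> b) \<partial>lborel)
          / ((2 * pi) powr (DIM('a) / 2) * r)
     \<le> measure M {\<omega> \<in> space M. b + X (real n) \<omega> \<in> ball 0 r}"
proof -
  interpret prob_space M by (rule prob_space_process)
  have [measurable]: "X (real n) \<in> borel_measurable M" by (rule measurable_process) simp
  let ?A = "{\<omega> \<in> space M. b + X (real n) \<omega> \<in> ball 0 r}"
  have A: "?A \<in> sets M" by (rule ball_event) simp
  have "(\<integral>\<omega>. tent r (b + X (real n) \<omega>) \<partial>M) \<le> (\<integral>\<omega>. r * indicator ?A \<omega> \<partial>M)"
  proof (rule integral_mono)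
    show "integrable M (\<lambda>\<omega>. tent r (b + X (real n) \<omega>))"
      by (rule integrable_const_bound[where B=r]) (use r in \<open>auto simp: tent_def\<close>)
    show "tent r (b + X (real n) \<omega>) \<le> r * indicator ?A \<omega>" if "\<omega> \<in> space M" for \<omega>
      using tent_le_indicator[OF r, of "b + X (real n) \<omega>"] that by (simp add: indicator_def)
  qed (use A in \<open>simp add: emeasure_eq_measure\<close>)
  also have "\<dots> = r * measure M ?A" using A by simp
  finally have "(\<integral>\<omega>. tent r (b + X (real n) \<omega>) \<partial>M) / r \<le> measure M ?A"
    using r by (simp add: field_simps)
  moreover have "0 \<le> (\<integral>\<omega>. tent r (b + X (real n) \<omega>) \<partial>M)"
    by (simp add: tent_nonneg)
  ultimately show ?thesis
    unfolding expectation_tent_eq[OF r n, symmetric] norm_of_real by (simp add: abs_mult)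
qed

section \<open>The hitting time\<close>

text \<open>The ball is open and the paths are right-continuous, so a path inside at time
  \<open>t\<close> is still inside at rational times just after \<open>t\<close>. The infimum may
  thus be taken over the countably many positive rationals.\<close>

lemma hitting_time_measurable:
  "(\<lambda>\<omega>. hitting_time R (\<lambda>t. x + X t \<omega>)) \<in> borel_measurable M"
proof -
  let ?h = "\<lambda>q \<omega>. if x + X q \<omega> \<in> ball 0 R then ereal q else \<infinity>"
  have eq: "hitting_time R (\<lambda>t. x + X t \<omega>) = (INF q\<in>{q\<in>\<rat>. 0 < q}. ?h q \<omega>)" if \<omega>: "\<omega> \<in> space M" for \<omega>
  proof (rule antisym)
    show "hitting_time R (\<lambda>t. x + X t \<omega>) \<le> (INF q\<in>{q\<in>\<rat>. 0 < q}. ?h q \<omega>)"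
      unfolding hitting_time_def by (rule INF_greatest) (auto intro!: Inf_lower)
    show "(INF q\<in>{q\<in>\<rat>. 0 < q}. ?h q \<omega>) \<le> hitting_time R (\<lambda>t. x + X t \<omega>)"
      unfolding hitting_time_def
    proof (rule Inf_greatest, clarify)
      fix t :: real assume t: "0 < t" "x + X t \<omega> \<in> ball 0 R"
      show "(INF q\<in>{q\<in>\<rat>. 0 < q}. ?h q \<omega>) \<le> ereal t"
      proof (rule ereal_le_epsilon2)
        fix e :: real assume "0 < e"
        have "((\<lambda>t. X t \<omega>) \<longlongrightarrow> X t \<omega>) (at_right t)"
          using X \<omega> t by (simp add: relativistic_stable_process_def cadlag_levy_process_def cadlag_def)
        then have "((\<lambda>t. x + X t \<omega>) \<longlongrightarrow> x + X t \<omega>) (at_right t)" by (intro tendsto_intros)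
        then have "eventually (\<lambda>s. x + X s \<omega> \<in> ball 0 R) (at_right t)"
          using t by (rule_tac topological_tendstoD) auto
        then obtain u where u: "t < u" "\<And>s. t < s \<Longrightarrow> s < u \<Longrightarrow> x + X s \<omega> \<in> ball 0 R"
          unfolding eventually_at_right_field by blast
        obtain q where q: "q \<in> \<rat>" "t < q" "q < min u (t + e)"
          using Rats_dense_in_real[of t "min u (t + e)"] u \<open>0 < e\<close> by auto
        have "(INF q\<in>{q\<in>\<rat>. 0 < q}. ?h q \<omega>) \<le> ?h q \<omega>"
          by (rule INF_lower) (use q t in auto)
        also have "\<dots> \<le> ereal t + ereal e" using q u(2)[of q] by simp
        finally show "(INF q\<in>{q\<in>\<rat>. 0 < q}. ?h q \<omega>) \<le> ereal t + ereal e" .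
      qed
    qed
  qed
  have "(\<lambda>\<omega>. INF q\<in>{q\<in>\<rat>. 0 < q}. ?h q \<omega>) \<in> borel_measurable M"
  proof (rule borel_measurable_INF)
    show "countable {q\<in>\<rat>. 0 < (q::real)}"
      by (rule countable_subset[OF _ countable_rat]) auto
    show "?h q \<in> borel_measurable M" if "q \<in> {q\<in>\<rat>. 0 < q}" for q
      using that by (intro measurable_If ball_event) auto
  qed
  then show ?thesis by (subst measurable_cong[OF eq])
qed

text \<open>A path in the ball at time \<open>t\<close> has hitting time at most \<open>t\<close>;
  strict positivity of \<open>t\<close> matters because only positive times count as hits.\<close>

lemma expectation_discount_ge:
  assumes lam: "0 < lam" and t: "0 < t"
  shows "exp (- lam * t) * measure M {\<omega> \<in> space M. x + X t \<omega> \<in> ball 0 R}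
    \<le> expectation_from M X x (\<lambda>p. exp_discount lam (hitting_time R p))"
proof -
  interpret prob_space M by (rule prob_space_process)
  have [measurable]: "X t \<in> borel_measurable M" using t by (intro measurable_process) simp
  let ?A = "{\<omega> \<in> space M. x + X t \<omega> \<in> ball 0 R}"
  let ?T = "\<lambda>\<omega>. hitting_time R (\<lambda>t. x + X t \<omega>)"
  have [measurable]: "?T \<in> borel_measurable M" by (rule hitting_time_measurable)
  have A: "?A \<in> sets M" using t by (intro ball_event) simp
  have T0: "0 \<le> ?T \<omega>" for \<omega>
    unfolding hitting_time_def by (rule Inf_greatest) auto
  have disc: "0 \<le> exp_discount lam (?T \<omega>)" "exp_discount lam (?T \<omega>) \<le> 1" for \<omega>
    using T0[of \<omega>] lam by (auto simp: exp_discount_def real_of_ereal_pos)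
  have meas: "(\<lambda>\<omega>. exp_discount lam (?T \<omega>)) \<in> borel_measurable M"
    unfolding exp_discount_def by measurable
  have "exp (- lam * t) * measure M ?A = (\<integral>\<omega>. exp (- lam * t) * indicator ?A \<omega> \<partial>M)"
    using A by simp
  also have "\<dots> \<le> (\<integral>\<omega>. exp_discount lam (?T \<omega>) \<partial>M)"
  proof (rule integral_mono)
    show "integrable M (\<lambda>\<omega>. exp_discount lam (?T \<omega>))"
      by (rule integrable_const_bound[where B=1, OF _ meas]) (simp add: disc)
    show "exp (- lam * t) * indicator ?A \<omega> \<le> exp_discount lam (?T \<omega>)" for \<omega>
    proof (cases "\<omega> \<in> ?A")
      case True
      then have "?T \<omega> \<le> ereal t"
        unfolding hitting_time_def using t by (intro Inf_lower) auto
      then obtain u where "?T \<omega> = ereal u" "u \<le> t"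
        using T0[of \<omega>] by (cases "?T \<omega>") auto
      then show ?thesis using True lam by (simp add: exp_discount_def)
    qed (simp add: disc)
  qed (use A in \<open>simp add: emeasure_eq_measure\<close>)
  finally show ?thesis by (simp add: expectation_from_def)
qed

end

section \<open>Boundedness of the Levy density\<close>

text \<open>For \<open>z\<close> at least \<open>a\<close> the factor
  \<open>exp (- a\<^sup>2 / (4 * t))\<close> tames the singularity at \<open>t = 0\<close>, and
  \<open>exp (- t)\<close> gives integrability at infinity. The upper limit \<open>c\<close>
  controls the power in front.\<close>

lemma bessel_K_bounded:
  fixes \<rho> :: real
  assumes "0 < a" "0 < \<rho>"
  shows "\<exists>J. \<forall>z. a \<le> z \<and> z \<le> c \<longrightarrow> bessel_K \<rho> z \<le> J"
proof -
  let ?k = "\<lambda>t. t powr (- \<rho> - 1) * exp (- a\<^sup>2 / (4 * t))"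
  have "((\<lambda>u. u powr (\<rho> + 1) * exp (- a\<^sup>2 / 4 * u)) \<longlongrightarrow> 0) at_top"
    using assms by real_asymp
  then have "eventually (\<lambda>u. u powr (\<rho> + 1) * exp (- a\<^sup>2 / 4 * u) < 1) at_top"
    by (rule order_tendstoD) simp
  then obtain U where U: "\<And>u. u \<ge> U \<Longrightarrow> u powr (\<rho> + 1) * exp (- a\<^sup>2 / 4 * u) \<le> 1"
    unfolding eventually_at_top_linorder by force
  define B where "B = 1 + (max U 0) powr (\<rho> + 1)"
  have k: "?k t \<le> B" if t: "0 < t" for t
  proof -
    \<comment> \<open>The inversion moves the singularity at 0 to infinity, where exponential decay
      beats the power.\<close>
    define u where "u = 1 / t"
    have u: "0 < u" using t by (simp add: u_def)
    have eq: "?k t = u powr (\<rho> + 1) * exp (- a\<^sup>2 / 4 * u)"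
      using t powr_minus_divide[of t "\<rho> + 1"] by (simp add: u_def powr_divide)
    show ?thesis
    proof (cases "U \<le> u")
      case True
      then show ?thesis unfolding eq B_def using U[OF True] by (smt (verit) powr_ge_zero)
    next
      case False
      have "u powr (\<rho> + 1) * exp (- a\<^sup>2 / 4 * u) \<le> u powr (\<rho> + 1) * 1"
        using u by (intro mult_left_mono) auto
      also have "\<dots> \<le> (max U 0) powr (\<rho> + 1)"
        using False u assms by (auto intro!: powr_mono2)
      finally show ?thesis unfolding eq B_def by simp
    qed
  qed
  have B0: "0 \<le> B" by (simp add: B_def)
  \<comment> \<open>The exponential is written so that \<open>integrable_exp_abs_powr\<close>
    applies with exponent 1.\<close>
  define E where "E = (\<integral>t. exp (- 1 * \<bar>t\<bar> powr 1) \<partial>(lborel :: real measure))"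
  have E0: "0 \<le> E" by (simp add: E_def)
  have int: "(LINT t:{0<..}|lborel. t powr (- \<rho> - 1) * exp (- t - z\<^sup>2 / (4 * t))) \<le> B * E" if z: "a \<le> z" for z
  proof -
    have "(LINT t:{0<..}|lborel. t powr (- \<rho> - 1) * exp (- t - z\<^sup>2 / (4 * t)))
       \<le> (\<integral>t. B * exp (- 1 * \<bar>t\<bar> powr 1) \<partial>lborel)"
      unfolding set_lebesgue_integral_def
    proof (rule integral_mono')
      show "integrable lborel (\<lambda>t::real. B * exp (- 1 * \<bar>t\<bar> powr 1))"
        by (intro integrable_mult_right integrable_exp_abs_powr) auto
      fix t :: real
      show "0 \<le> B * exp (- 1 * \<bar>t\<bar> powr 1)" using B0 by simp
      show "indicator {0<..} t *\<^sub>R (t powr (- \<rho> - 1) * exp (- t - z\<^sup>2 / (4 * t))) \<le> B * exp (- 1 * \<bar>t\<bar> powr 1)"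
      proof (cases "0 < t")
        case True
        have "a\<^sup>2 / (4 * t) \<le> z\<^sup>2 / (4 * t)"
          using assms z True by (intro divide_right_mono power_mono) auto
        then have "exp (- t - z\<^sup>2 / (4 * t)) \<le> exp (- a\<^sup>2 / (4 * t)) * exp (- t)"
          by (simp flip: exp_add)
        then have "t powr (- \<rho> - 1) * exp (- t - z\<^sup>2 / (4 * t)) \<le> ?k t * exp (- t)"
          unfolding mult.assoc by (intro mult_left_mono) auto
        also have "\<dots> \<le> B * exp (- t)" by (intro mult_right_mono k True) simp
        finally show ?thesis using True by simp
      qed (use B0 in simp)
    qed
    then show ?thesis by (simp add: E_def)
  qed
  have "bessel_K \<rho> z \<le> 1 / 2 * (c / 2) powr \<rho> * (B * E)" if z: "a \<le> z" "z \<le> c" for z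
    unfolding bessel_K_def using assms z B0 E0 int[OF z(1)]
    by (intro mult_mono powr_mono2 mult_nonneg_nonneg) (auto simp: set_lebesgue_integral_def)
  then show ?thesis by blast
qed

text \<open>For \<open>m = 0\<close> the power is decreasing in the radius; otherwise the Bessel
  bound is used on the rescaled interval. Absolute values of the constants replace a discussion of
  the signs of the Gamma factors.\<close>

lemma levy_density_bounded:
  assumes "0 < a" "0 < \<alpha>" "0 \<le> m"
  shows "\<exists>J>0. \<forall>r. a \<le> r \<and> r \<le> c \<longrightarrow> levy_density d m \<alpha> r \<le> J"
proof -
  have bd: "\<exists>J. \<forall>r. a \<le> r \<and> r \<le> c \<longrightarrow> levy_density d m \<alpha> r \<le> J"
  proof (cases "m = 0")
    case True
    let ?K = "2 powr \<alpha> * Gamma ((real d + \<alpha>) / 2) / (pi powr (real d / 2) * \<bar>Gamma (- (\<alpha> / 2))\<bar>)"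
    have "levy_density d m \<alpha> r \<le> \<bar>?K\<bar> * a powr (- real d - \<alpha>)" if "a \<le> r" for r
    proof -
      have "r powr (- real d - \<alpha>) \<le> a powr (- real d - \<alpha>)"
        using assms that by (intro powr_mono2') auto
      then have "?K * r powr (- real d - \<alpha>) \<le> \<bar>?K\<bar> * a powr (- real d - \<alpha>)"
        by (intro mult_mono abs_ge_self abs_ge_zero powr_ge_zero)
      then show ?thesis by (simp only: levy_density_def True refl if_True)
    qed
    then show ?thesis by blast
  next
    case False
    then have m: "0 < m" using assms by simp
    let ?\<rho> = "(real d + \<alpha>) / 2"
    let ?s = "m powr (1 / \<alpha>)"
    let ?K = "2 powr ((\<alpha> - real d) / 2) * m powr ((real d + \<alpha>) / (2 * \<alpha>)) * \<alpha>
          / (pi powr (real d / 2) * Gamma (1 - \<alpha> / 2))"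
    have s: "0 < ?s" using m by simp
    have "\<exists>J. \<forall>z. ?s * a \<le> z \<and> z \<le> ?s * c \<longrightarrow> bessel_K ?\<rho> z \<le> J"
      by (rule bessel_K_bounded) (use assms s in \<open>auto intro!: mult_pos_pos add_nonneg_pos\<close>)
    then obtain J where J: "\<And>z. ?s * a \<le> z \<Longrightarrow> z \<le> ?s * c \<Longrightarrow> bessel_K ?\<rho> z \<le> J" by blast
    have "levy_density d m \<alpha> r \<le> \<bar>?K\<bar> * (\<bar>J\<bar> / a powr ?\<rho>)" if r: "a \<le> r" "r \<le> c" for r
    proof -
      have b0: "0 \<le> bessel_K ?\<rho> (?s * r)"
        unfolding bessel_K_def set_lebesgue_integral_def by (intro mult_nonneg_nonneg integral_nonneg_AE) auto
      have "bessel_K ?\<rho> (?s * r) \<le> \<bar>J\<bar>"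
        using J[of "?s * r"] r s by (simp add: mult_left_mono)
      moreover have "a powr ?\<rho> \<le> r powr ?\<rho>" using assms r by (intro powr_mono2) auto
      ultimately have "bessel_K ?\<rho> (?s * r) / r powr ?\<rho> \<le> \<bar>J\<bar> / a powr ?\<rho>"
        using assms b0 by (intro frac_le) auto
      then have "?K * (bessel_K ?\<rho> (?s * r) / r powr ?\<rho>) \<le> \<bar>?K\<bar> * (\<bar>J\<bar> / a powr ?\<rho>)"
        using b0 by (intro mult_mono abs_ge_self abs_ge_zero divide_nonneg_nonneg powr_ge_zero)
      then show ?thesis by (simp only: levy_density_def False if_False)
    qed
    then show ?thesis by blast
  qed
  then obtain J where "\<And>r. a \<le> r \<and> r \<le> c \<Longrightarrow> levy_density d m \<alpha> r \<le> J" by blast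
  then have "\<forall>r. a \<le> r \<and> r \<le> c \<longrightarrow> levy_density d m \<alpha> r \<le> \<bar>J\<bar> + 1" by force
  moreover have "0 < \<bar>J\<bar> + 1" by simp
  ultimately show ?thesis by blast
qed

theorem theorem3p2:
  fixes m \<alpha> lam R R\<^sub>1 R\<^sub>2 :: real
  assumes "0 < \<alpha>" "\<alpha> < 2" "0 \<le> m" "0 < lam" "0 < R" "R < R\<^sub>1" "R\<^sub>1 < R\<^sub>2"
  shows "\<exists>C>0. \<forall>(M :: 'w measure) (X :: real \<Rightarrow> 'w \<Rightarrow> 'a::euclidean_space).
           relativistic_stable_process m \<alpha> M X \<longrightarrow>
           (\<forall>x. R\<^sub>1 \<le> norm x \<and> norm x \<le> R\<^sub>2 \<longrightarrow>
              expectation_from M X x (\<lambda>p. exp_discount lam (hitting_time R p))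
                \<ge> C * levy_density DIM('a) m \<alpha> (norm x))"
proof -
  \<comment> \<open>One half of the radius is spent on moving the starting point from
    \<open>b\<close> to \<open>x\<close>, the other on the event for the process started at
    \<open>b\<close>.\<close>
  define r where "r = R / 2"
  have r: "0 < r" using assms by (simp add: r_def)
  \<comment> \<open>This is the lower bound of \<open>prob_ball_ge\<close>. It involves neither
    \<open>M\<close> nor \<open>X\<close>, so times, cover and constant can all be fixed before a
    process is given.\<close>
  define Q where "Q n b = norm (\<integral>y. fourier_integral (\<lambda>x. complex_of_real (tent r x)) y
            * of_real (exp (- real n * Phi m \<alpha> ((norm y)\<^sup>2))) * cis (y \<bullet> b) \<partial>lborel)
          / ((2 * pi) powr (DIM('a) / 2) * r)" for n and b :: 'a
  have "\<forall>b. \<exists>n\<ge>1. 0 < Q n b"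
  proof
    fix b :: 'a
    obtain n where "1 \<le> n" "(\<integral>y. fourier_integral (\<lambda>x. complex_of_real (tent r x)) y
            * of_real (exp (- real n * Phi m \<alpha> ((norm y)\<^sup>2))) * cis (y \<bullet> b) \<partial>lborel) \<noteq> 0"
      using exists_time_nonzero[OF assms(1-3) r] by blast
    then show "\<exists>n\<ge>1. 0 < Q n b"
      using r unfolding Q_def by (intro exI[of _ n] conjI divide_pos_pos mult_pos_pos) (simp_all only: zero_less_norm_iff, simp_all)
  qed
  then obtain n where n: "\<And>b. 1 \<le> n b" "\<And>b. 0 < Q (n b) b" by metis
  have cover: "cball (0::'a) R\<^sub>2 \<subseteq> (\<Union>b\<in>UNIV. ball b r)"
    using r by (meson UNIV_I UN_I centre_in_ball subsetI)
  obtain B where B: "finite B" "cball (0::'a) R\<^sub>2 \<subseteq> (\<Union>b\<in>B. ball b r)"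
    by (rule compactE_image[OF compact_cball _ cover]) auto
  define c where "c b = exp (- lam * real (n b)) * Q (n b) b" for b
  have c: "0 < c b" for b unfolding c_def using n(2)[of b] by (intro mult_pos_pos) auto
  \<comment> \<open>Inserting 1 ensures that the minimum is over a nonempty set of positive
    numbers.\<close>
  define C\<^sub>0 where "C\<^sub>0 = Min (insert 1 (c ` B))"
  have C\<^sub>0: "0 < C\<^sub>0" "\<And>b. b \<in> B \<Longrightarrow> C\<^sub>0 \<le> c b"
    using B(1) c by (auto simp: C\<^sub>0_def)
  obtain J where J: "0 < J" "\<And>s. R\<^sub>1 \<le> s \<Longrightarrow> s \<le> R\<^sub>2 \<Longrightarrow> levy_density DIM('a) m \<alpha> s \<le> J"
    using levy_density_bounded[of R\<^sub>1 \<alpha> m R\<^sub>2 "DIM('a)"] assms by force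
  show ?thesis
  proof (intro exI[of _ "C\<^sub>0 / J"] conjI allI impI)
    show "0 < C\<^sub>0 / J" using C\<^sub>0 J by simp
    fix M :: "'w measure" and X :: "real \<Rightarrow> 'w \<Rightarrow> 'a" and x :: 'a
    assume X: "relativistic_stable_process m \<alpha> M X" and x: "R\<^sub>1 \<le> norm x \<and> norm x \<le> R\<^sub>2"
    interpret prob_space M by (rule prob_space_process[OF assms(1-3) X])
    obtain b where b: "b \<in> B" "x \<in> ball b r" using B(2) x by fastforce
    let ?t = "real (n b)"
    have [measurable]: "X ?t \<in> borel_measurable M"
      by (rule measurable_process[OF assms(1-3) X]) simp
    have "C\<^sub>0 / J * levy_density DIM('a) m \<alpha> (norm x) \<le> C\<^sub>0 / J * J"
      using C\<^sub>0 J x by (intro mult_left_mono) auto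
    also have "\<dots> \<le> c b" using J C\<^sub>0(2)[OF b(1)] by simp
    also have "\<dots> \<le> exp (- lam * ?t) * measure M {\<omega> \<in> space M. b + X ?t \<omega> \<in> ball 0 r}"
      unfolding c_def Q_def by (intro mult_left_mono prob_ball_ge[OF assms(1-3) X r n(1)]) simp
    also have "\<dots> \<le> exp (- lam * ?t) * measure M {\<omega> \<in> space M. x + X ?t \<omega> \<in> ball 0 R}"
    proof (intro mult_left_mono finite_measure_mono)
      show "{\<omega> \<in> space M. b + X ?t \<omega> \<in> ball 0 r} \<subseteq> {\<omega> \<in> space M. x + X ?t \<omega> \<in> ball 0 R}"
      proof clarsimp
        fix \<omega> assume "norm (b + X ?t \<omega>) < r"
        moreover have "norm (x - b) < r" using b(2) by (simp add: dist_norm norm_minus_commute)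
        moreover have "x + X ?t \<omega> = (x - b) + (b + X ?t \<omega>)" by simp
        ultimately show "norm (x + X ?t \<omega>) < R"
          unfolding r_def by (metis (no_types, lifting) add_strict_mono field_sum_of_halves norm_triangle_lt)
      qed
      show "{\<omega> \<in> space M. x + X ?t \<omega> \<in> ball 0 R} \<in> events"
        by (rule ball_event[OF assms(1-3) X]) simp
    qed simp
    also have "\<dots> \<le> expectation_from M X x (\<lambda>p. exp_discount lam (hitting_time R p))"
      by (rule expectation_discount_ge[OF assms(1-3) X assms(4)]) (use n(1)[of b] in simp)
    finally show "C\<^sub>0 / J * levy_density DIM('a) m \<alpha> (norm x)
      \<le> expectation_from M X x (\<lambda>p. exp_discount lam (hitting_time R p))" .
  qed
qed

end
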